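(* Let $V:\mathbb{R}^d\times\Omega\to\mathbb{R}$ be a Gaussian process on a complete probability space $(\Omega,\mathscr{F},P)$ with mean function $m(y)=\mathbb{E}[V(y)]$ and covariance function $k(y,y')=\mathrm{Cov}(V(y),V(y'))$. Assume that $m\in C^3(\mathbb{R}^d)$, that $k\in C^6(\mathbb{R}^d\times\mathbb{R}^d)$, and that all partial derivatives of $k$ up to order $6$ are bounded on $\mathbb{R}^d\times\mathbb{R}^d$. Then for any compact set $D\subset\mathbb{R}^d$ there exist finite constants $C_1(D),C_2(D),C_3(D)>0$ such that $$\mathbb{E}\Big[\sup_{y\in D}\|\nabla V(y)\|^2\Big]\le C_1(D),\qquad \mathbb{E}\Big[\sup_{y\in D}\|D^2V(y)\|_{\mathrm{op}}^2\Big]\le C_2(D),\qquad \mathbb{E}\Big[\sup_{y\in D}\|D^3V(y)\|_{\mathrm{op}}^2\Big]\le C_3(D).$$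
   Context: A stochastic process $V:\mathbb{R}^d\times\Omega\to\mathbb{R}$ is a Gaussian process if for every finite set $\{y_1,\dots,y_m\}\subset\mathbb{R}^d$ the vector $(V(y_1),\dots,V(y_m))$ is multivariate Gaussian. Standing convention: $V$ is identified with a version whose sample paths $V(\cdot,\omega)$ belong to $C^3(\mathbb{R}^d)$ for $P$-almost every $\omega$. $\nabla V$, $D^2V$, $D^3V$ denote the gradient, the Hessian and the third derivative tensor in $y$, where $D^3V(y)[v_1,v_2]=\sum_{i,j,k=1}^d \frac{\partial^3V}{\partial y_i\partial y_j\partial y_k}(y)(v_1)_i(v_2)_j e_k$ with $(e_k)$ the standard basis of $\mathbb{R}^d$. $\|\cdot\|$ is the Euclidean norm; $\|A\|_{\mathrm{op}}$ for a matrix is the operator norm induced by the Euclidean norm; for a 3-tensor, $\|T\|_{\mathrm{op}}=\sup_{\|v_1\|=\|v_2\|=1}\|T[v_1,v_2]\|$. *)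

theory Defs
  imports "HOL-Probability.Probability"
begin

section \<open>Partial derivatives and the classes $C^n$\<close>

definition partial :: "'a::euclidean_space \<Rightarrow> ('a \<Rightarrow> real) \<Rightarrow> 'a \<Rightarrow> real" where
  "partial b f x = deriv (\<lambda>t. f (x + t *\<^sub>R b)) 0"

text \<open>For a list \<open>[b\<^sub>1, \<dots>, b\<^sub>n]\<close> the last direction is differentiated first.\<close>

primrec iter_partial :: "'a::euclidean_space list \<Rightarrow> ('a \<Rightarrow> real) \<Rightarrow> 'a \<Rightarrow> real" where
  "iter_partial [] f = f"
| "iter_partial (b # bs) f = partial b (iter_partial bs f)"

text \<open>Since \<open>deriv\<close> is total, existence of each partial derivative has to be demanded
  explicitly. On a product space, \<open>Basis\<close> consists of the basis vectors of both factors.\<close>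

definition Cn :: "nat \<Rightarrow> ('a::euclidean_space \<Rightarrow> real) \<Rightarrow> bool" where
  "Cn n f \<longleftrightarrow>
     (\<forall>bs b x. set bs \<subseteq> Basis \<and> length bs < n \<and> b \<in> Basis \<longrightarrow>
        (\<lambda>t. iter_partial bs f (x + t *\<^sub>R b)) field_differentiable (at 0)) \<and>
     (\<forall>bs. set bs \<subseteq> Basis \<and> length bs \<le> n \<longrightarrow> continuous_on UNIV (iter_partial bs f))"

definition grad :: "(real^'d \<Rightarrow> real) \<Rightarrow> real^'d \<Rightarrow> real^'d" where
  "grad f y = (\<chi> i. iter_partial [axis i 1] f y)"

definition hess :: "(real^'d \<Rightarrow> real) \<Rightarrow> real^'d \<Rightarrow> real^'d^'d" where
  "hess f y = (\<chi> i j. iter_partial [axis i 1, axis j 1] f y)"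

definition third_deriv ::
  "(real^'d \<Rightarrow> real) \<Rightarrow> real^'d \<Rightarrow> real^'d \<Rightarrow> real^'d \<Rightarrow> real^'d" where
  "third_deriv f y v1 v2 =
     (\<Sum>i\<in>UNIV. \<Sum>j\<in>UNIV. \<Sum>k\<in>UNIV.
        (iter_partial [axis i 1, axis j 1, axis k 1] f y * v1 $ i * v2 $ j) *\<^sub>R axis k 1)"

definition matrix_op_norm :: "real^'d^'d \<Rightarrow> real" where
  "matrix_op_norm A = onorm (\<lambda>v. A *v v)"

definition tensor_op_norm :: "(real^'d \<Rightarrow> real^'d \<Rightarrow> real^'d) \<Rightarrow> real" where
  "tensor_op_norm T = (SUP (v1, v2) \<in> {(v1, v2). norm v1 = 1 \<and> norm v2 = 1}. norm (T v1 v2))"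


section \<open>Gaussian processes\<close>

text \<open>Point masses count as (degenerate) Gaussian laws.\<close>

definition gaussian_rv :: "'w measure \<Rightarrow> ('w \<Rightarrow> real) \<Rightarrow> bool" where
  "gaussian_rv M X \<longleftrightarrow> X \<in> borel_measurable M \<and>
     (\<exists>\<mu> \<sigma>. (\<sigma> = 0 \<and> (AE \<omega> in M. X \<omega> = \<mu>)) \<or>
            (\<sigma> > 0 \<and> distributed M lborel X (normal_density \<mu> \<sigma>)))"

text \<open>A random vector indexed by a finite set is multivariate Gaussian if every linear
  combination of its components is a univariate Gaussian random variable.\<close>

definition multivariate_gaussian :: "'w measure \<Rightarrow> 'i set \<Rightarrow> ('i \<Rightarrow> 'w \<Rightarrow> real) \<Rightarrow> bool" where
  "multivariate_gaussian M I X \<longleftrightarrow>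
     (\<forall>c :: 'i \<Rightarrow> real. gaussian_rv M (\<lambda>\<omega>. \<Sum>i\<in>I. c i * X i \<omega>))"

definition gaussian_process :: "'w measure \<Rightarrow> ('i \<Rightarrow> 'w \<Rightarrow> real) \<Rightarrow> bool" where
  "gaussian_process M V \<longleftrightarrow> (\<forall>I. finite I \<longrightarrow> multivariate_gaussian M I V)"

definition covariance :: "'w measure \<Rightarrow> ('w \<Rightarrow> real) \<Rightarrow> ('w \<Rightarrow> real) \<Rightarrow> real" where
  "covariance M X Y =
     (\<integral>\<omega>. (X \<omega> - (\<integral>\<omega>'. X \<omega>' \<partial>M)) * (Y \<omega> - (\<integral>\<omega>'. Y \<omega>' \<partial>M)) \<partial>M)"

text \<open>\<open>E[Z] \<le> C\<close> for an extended nonnegative random variable \<open>Z\<close>. As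
  \<open>nn_integral\<close> is only a lower integral on nonmeasurable functions, measurability is part of
  the claim.\<close>

definition expectation_le :: "'w measure \<Rightarrow> ('w \<Rightarrow> ennreal) \<Rightarrow> real \<Rightarrow> bool" where
  "expectation_le M Z C \<longleftrightarrow> Z \<in> borel_measurable M \<and> (\<integral>\<^sup>+\<omega>. Z \<omega> \<partial>M) \<le> ennreal C"

end

theory Submission
  imports Defs
begin

text \<open>
  The bounds are an instance of Fernique's theorem: a countable centered Gaussian family that is
  almost surely bounded has a square integrable supremum. It applies to every partial derivative
  \<open>\<partial>\<^sup>\<alpha> (V - m)\<close> of order at most three. Such a derivative is an almost sure limit of difference
  quotients of derivatives of one order less, and almost sure limits of centered Gaussian variables
  are centered Gaussian; its paths are continuous, hence bounded on the compact set \<open>D\<close>, and by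
  continuity the supremum over \<open>D\<close> is the supremum over a countable dense subset. The
  deterministic derivative of \<open>m\<close> is bounded on \<open>D\<close> and is added back at the end. The three norms in
  the theorem are seminorms of finitely many partial derivatives, so each squared norm is at most a
  constant times the sum of their squares (\<open>expectation_le_SUP_partial_derivatives\<close>).

  Fernique's theorem is proved by rotating an independent copy. If \<open>X\<close> and \<open>Y\<close> are independent
  copies of the same centered Gaussian family, then the pair \<open>((X - Y) / \<surd>2, (X + Y) / \<surd>2)\<close> has
  the law of \<open>(X, Y)\<close> (\<open>rotation_invariance\<close>). Let \<open>K\<^sub>X\<close> be the maximum of the squares of finitely many
  members, and let \<open>c\<close> be so large that \<open>q = P(K\<^sub>X > c)\<close> is at most 1/10. Where the rotated variables
  \<open>(X\<^sub>i - Y\<^sub>i) / \<surd>2\<close> all have square at most \<open>c\<close>, the values \<open>X\<^sub>i\<close> and \<open>Y\<^sub>i\<close> are close together, so the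
  maximum for the other half of the pair is at most \<open>4 min(K\<^sub>X, K\<^sub>Y) + 2c\<close>, while
  \<open>min(K\<^sub>X, K\<^sub>Y)\<close> is at most \<open>c\<close> unless \<open>K\<^sub>Y > c\<close>. Taking expectations and using independence twice
  gives \<open>(1 - q) E K \<le> 6c + 4q E K\<close>, hence \<open>E K \<le> 12c\<close>, with \<open>c\<close> independent of the number of members
  (\<open>fernique_finite\<close>).

  Both the rotation and the limits are handled through characteristic functions. This needs the fact
  that they determine the joint law of finitely many real random variables (\<open>distr_PiM_eqI_char\<close>),
  which is reduced to the uniqueness theorem on the line by treating one coordinate at a time.
\<close>


section \<open>Characteristic functions determine finite-dimensional laws\<close>

text \<open>Uniqueness of characteristic functions for weighted laws: dividing the weights by their common
  total mass, the case \<open>t = 0\<close> of the hypothesis, turns both sides into probability measures, to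
  which the uniqueness theorem on the line applies. Weights of at least 1 make the mass positive.\<close>

lemma indicator_expectation_eqI_pos:
  fixes X :: "'a \<Rightarrow> real" and Y :: "'b \<Rightarrow> real" and h :: "'a \<Rightarrow> real" and h' :: "'b \<Rightarrow> real"
  assumes "prob_space M" "prob_space N"
    and [measurable]: "X \<in> borel_measurable M" "Y \<in> borel_measurable N"
      "h \<in> borel_measurable M" "h' \<in> borel_measurable N"
    and b: "\<And>x. 1 \<le> h x" "\<And>x. h x \<le> C" "\<And>y. 1 \<le> h' y" "\<And>y. h' y \<le> C"
    and eq: "\<And>t. (CLINT x|M. h x * iexp (t * X x)) = (CLINT y|N. h' y * iexp (t * Y y))"
    and [measurable]: "B \<in> sets borel"
  shows "(\<integral>x. h x * indicator B (X x) \<partial>M) = (\<integral>y. h' y * indicator B (Y y) \<partial>N)"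
proof -
  interpret M: prob_space M by fact
  interpret N: prob_space N by fact
  have int [simp]: "integrable M h" "integrable N h'"
    by (auto intro!: M.integrable_const_bound[where B = C] N.integrable_const_bound[where B = C]
        AE_I2 simp: abs_le_iff intro: order_trans[OF b(2)] order_trans[OF b(4)])
       (use b in \<open>smt (verit)\<close>)+
  define c where "c = (\<integral>x. h x \<partial>M)"
  have c': "c = (\<integral>y. h' y \<partial>N)"
    using eq[of 0] by (simp add: c_def)
  have c1: "c \<ge> 1"
    unfolding c_def using b by (intro M.integral_ge_const) auto
  define P where "P = density M (\<lambda>x. ennreal (h x / c))"
  define Q where "Q = density N (\<lambda>x. ennreal (h' x / c))"
  have nn: "0 \<le> h x / c" "0 \<le> h' y / c" for x y
    using b(1)[of x] b(3)[of y] c1 by auto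
  interpret P: prob_space P
  proof
    have "emeasure P (space P) = (\<integral>\<^sup>+x. ennreal (h x / c) \<partial>M)"
      by (simp add: P_def emeasure_density cong: nn_integral_cong)
    also have "\<dots> = ennreal (\<integral>x. h x / c \<partial>M)"
      using nn by (intro nn_integral_eq_integral) auto
    finally show "emeasure P (space P) = 1"
      using c1 by (simp add: c_def)
  qed
  interpret Q: prob_space Q
  proof
    have "emeasure Q (space Q) = (\<integral>\<^sup>+x. ennreal (h' x / c) \<partial>N)"
      by (simp add: Q_def emeasure_density cong: nn_integral_cong)
    also have "\<dots> = ennreal (\<integral>x. h' x / c \<partial>N)"
      using nn by (intro nn_integral_eq_integral) auto
    finally show "emeasure Q (space Q) = 1"
      using c1 by (simp add: c')
  qed
  have [measurable]: "X \<in> borel_measurable P" "Y \<in> borel_measurable Q"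
    by (simp_all add: P_def Q_def)
  have "distr P borel X = distr Q borel Y"
  proof (rule Levy_uniqueness)
    show "real_distribution (distr P borel X)" "real_distribution (distr Q borel Y)"
      by (simp_all)
    show "char (distr P borel X) = char (distr Q borel Y)"
    proof
      fix t
      have "char (distr P borel X) t = (CLINT x|P. iexp (t * X x))"
        by (simp add: char_def integral_distr)
      also have "\<dots> = (CLINT x|M. (h x / c) *\<^sub>R iexp (t * X x))"
        unfolding P_def using nn by (subst integral_density) auto
      also have "\<dots> = (CLINT x|M. h x * iexp (t * X x)) / c"
        by (subst integral_divide_zero[symmetric]) (simp add: scaleR_conv_of_real)
      also have "\<dots> = (CLINT x|N. h' x * iexp (t * Y x)) / c"
        by (simp only: eq)
      also have "\<dots> = (CLINT x|N. (h' x / c) *\<^sub>R iexp (t * Y x))"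
        by (subst integral_divide_zero[symmetric]) (simp add: scaleR_conv_of_real)
      also have "\<dots> = (CLINT x|Q. iexp (t * Y x))"
        unfolding Q_def using nn by (subst integral_density) auto
      also have "\<dots> = char (distr Q borel Y) t"
        by (simp add: char_def integral_distr)
      finally show "char (distr P borel X) t = char (distr Q borel Y) t" .
    qed
  qed
  then have "(\<integral>x. indicator B x \<partial>distr P borel X) = (\<integral>x. (indicator B x :: real) \<partial>distr Q borel Y)"
    by simp
  moreover have "(\<integral>x. indicator B x \<partial>distr P borel X) = (\<integral>x. (indicator B (X x) :: real) \<partial>P)"
    by (rule integral_distr) auto
  moreover have "(\<integral>x. indicator B x \<partial>distr Q borel Y) = (\<integral>x. (indicator B (Y x) :: real) \<partial>Q)"
    by (rule integral_distr) auto
  ultimately have "(\<integral>x. indicator B (X x) \<partial>P) = (\<integral>x. (indicator B (Y x) :: real) \<partial>Q)"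
    by simp
  then have "(\<integral>x. (h x / c) *\<^sub>R (indicator B (X x) :: real) \<partial>M)
      = (\<integral>x. (h' x / c) *\<^sub>R (indicator B (Y x) :: real) \<partial>N)"
    unfolding P_def Q_def using nn
    by (subst (asm) integral_density; (simp; fail)?)
       (subst (asm) integral_density; (simp; fail)?)
  then have "(\<integral>x. h x * indicator B (X x) / c \<partial>M) = (\<integral>x. h' x * indicator B (Y x) / c \<partial>N)"
    by simp
  then show ?thesis
    using c1 by (simp add: integral_divide_zero)
qed

text \<open>Signed weights are made positive by adding the constant 2; the contribution of the constant is
  removed again by means of the unweighted identity.\<close>

lemma indicator_expectation_eqI_real:
  fixes X :: "'a \<Rightarrow> real" and Y :: "'b \<Rightarrow> real" and h :: "'a \<Rightarrow> real" and h' :: "'b \<Rightarrow> real"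
  assumes "prob_space M" "prob_space N"
    and [measurable]: "X \<in> borel_measurable M" "Y \<in> borel_measurable N"
      "h \<in> borel_measurable M" "h' \<in> borel_measurable N"
    and b: "\<And>x. \<bar>h x\<bar> \<le> 1" "\<And>y. \<bar>h' y\<bar> \<le> 1"
    and eq1: "\<And>t. (CLINT x|M. iexp (t * X x)) = (CLINT y|N. iexp (t * Y y))"
    and eq: "\<And>t. (CLINT x|M. h x * iexp (t * X x)) = (CLINT y|N. h' y * iexp (t * Y y))"
    and [measurable]: "B \<in> sets borel"
  shows "(\<integral>x. h x * indicator B (X x) \<partial>M) = (\<integral>y. h' y * indicator B (Y y) \<partial>N)"
proof -
  interpret M: prob_space M by fact
  interpret N: prob_space N by fact
  have iM: "integrable M (\<lambda>x. h x * iexp (t * X x))" "integrable M (\<lambda>x. iexp (t * X x))" for t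
    using b by (auto intro!: M.integrable_const_bound[where B = 1] AE_I2
        simp: norm_mult simp del: of_real_mult)
  have iM': "integrable M (\<lambda>x. h x * indicator B (X x))" "integrable M (\<lambda>x. indicator B (X x) :: real)"
    using b by (auto intro!: M.integrable_const_bound[where B = 1] AE_I2
        simp: norm_mult indicator_def simp del: of_real_mult)
  have iN: "integrable N (\<lambda>x. h' x * iexp (t * Y x))" "integrable N (\<lambda>x. iexp (t * Y x))" for t
    using b by (auto intro!: N.integrable_const_bound[where B = 1] AE_I2
        simp: norm_mult simp del: of_real_mult)
  have iN': "integrable N (\<lambda>x. h' x * indicator B (Y x))" "integrable N (\<lambda>x. indicator B (Y x) :: real)"
    using b by (auto intro!: N.integrable_const_bound[where B = 1] AE_I2
        simp: norm_mult indicator_def simp del: of_real_mult)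
  have "(\<integral>x. (2 + h x) * indicator B (X x) \<partial>M) = (\<integral>y. (2 + h' y) * indicator B (Y y) \<partial>N)"
  proof (rule indicator_expectation_eqI_pos[where C = 3])
    fix t
    have "(CLINT x|M. (2 + h x) * iexp (t * X x)) = 2 * (CLINT x|M. iexp (t * X x)) + (CLINT x|M. h x * iexp (t * X x))"
      using iM[of t] by (simp add: distrib_right del: of_real_mult)
    also have "\<dots> = 2 * (CLINT x|N. iexp (t * Y x)) + (CLINT x|N. h' x * iexp (t * Y x))"
      by (simp only: eq eq1)
    also have "\<dots> = (CLINT x|N. (2 + h' x) * iexp (t * Y x))"
      using iN[of t] by (simp add: distrib_right del: of_real_mult)
    finally show "(CLINT x|M. complex_of_real (2 + h x) * iexp (t * X x)) =
        (CLINT x|N. complex_of_real (2 + h' x) * iexp (t * Y x))"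
      by simp
  qed (use b in \<open>simp_all add: abs_le_iff assms(1,2); smt (verit)\<close>)+
  moreover have "(\<integral>x. 1 * indicator B (X x) \<partial>M) = (\<integral>y. (1::real) * indicator B (Y y) \<partial>N)"
    by (rule indicator_expectation_eqI_pos[where C = 1]) (use eq1 in \<open>simp_all add: assms(1,2)\<close>)
  ultimately show ?thesis
    using iM' iN' by (simp add: distrib_right del: integral_indicator)
qed

lemma integral_iexp_cnj:
  fixes X :: "'a \<Rightarrow> real" and h :: "'a \<Rightarrow> complex"
  shows "(CLINT x|M. cnj (h x) * iexp (t * X x)) = cnj (CLINT x|M. h x * iexp ((- t) * X x))"
proof -
  have "cnj (CLINT x|M. h x * iexp ((- t) * X x)) = (CLINT x|M. cnj (h x * iexp ((- t) * X x)))"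
    by (rule Bochner_Integration.integral_cnj[symmetric])
  then show ?thesis
    by (simp add: exp_cnj)
qed

text \<open>Conjugating the hypothesis and replacing \<open>t\<close> by \<open>-t\<close> gives it for the conjugate weights as well,
  hence for their real and imaginary parts. Complex weights are what the coordinatewise argument
  below needs: there the weight contains the exponentials of the other coordinates.\<close>

lemma indicator_expectation_eqI:
  fixes X :: "'a \<Rightarrow> real" and Y :: "'b \<Rightarrow> real" and h :: "'a \<Rightarrow> complex" and h' :: "'b \<Rightarrow> complex"
  assumes "prob_space M" "prob_space N"
    and [measurable]: "X \<in> borel_measurable M" "Y \<in> borel_measurable N"
      "h \<in> borel_measurable M" "h' \<in> borel_measurable N"
    and b: "\<And>x. cmod (h x) \<le> 1" "\<And>y. cmod (h' y) \<le> 1"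
    and eq1: "\<And>t. (CLINT x|M. iexp (t * X x)) = (CLINT y|N. iexp (t * Y y))"
    and eq: "\<And>t. (CLINT x|M. h x * iexp (t * X x)) = (CLINT y|N. h' y * iexp (t * Y y))"
    and [measurable]: "B \<in> sets borel"
  shows "(CLINT x|M. h x * indicator B (X x)) = (CLINT y|N. h' y * indicator B (Y y))"
proof -
  interpret M: prob_space M by fact
  interpret N: prob_space N by fact
  have [measurable]: "cnj \<in> borel_measurable borel"
    by (intro borel_measurable_continuous_onI continuous_intros)
  have iM: "integrable M (\<lambda>x. h x * iexp (t * X x))" "integrable M (\<lambda>x. cnj (h x) * iexp (t * X x))" for t
    using b by (auto intro!: M.integrable_const_bound[where B = 1] AE_I2
        simp: norm_mult simp del: of_real_mult)
  have iN: "integrable N (\<lambda>x. h' x * iexp (t * Y x))" "integrable N (\<lambda>x. cnj (h' x) * iexp (t * Y x))" for t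
    using b by (auto intro!: N.integrable_const_bound[where B = 1] AE_I2
        simp: norm_mult simp del: of_real_mult)
  have eqc: "(CLINT x|M. cnj (h x) * iexp (t * X x)) = (CLINT y|N. cnj (h' y) * iexp (t * Y y))" for t
    by (simp only: integral_iexp_cnj eq)
  have Re: "complex_of_real (Re z) = (z + cnj z) / 2" for z
    by (simp add: complex_eq_iff)
  have Im: "complex_of_real (Im z) = c * cnj z - c * z" if "c = \<i> / 2" for z c
    using that by (simp add: complex_eq_iff)
  have iMB: "integrable M (\<lambda>x. h x * indicator B (X x))"
    using b by (auto intro!: M.integrable_const_bound[where B = 1] AE_I2 simp: norm_mult indicator_def)
  have iNB: "integrable N (\<lambda>x. h' x * indicator B (Y x))"
    using b by (auto intro!: N.integrable_const_bound[where B = 1] AE_I2 simp: norm_mult indicator_def)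
  have "(\<integral>x. Re (h x) * indicator B (X x) \<partial>M) = (\<integral>y. Re (h' y) * indicator B (Y y) \<partial>N)"
  proof (rule indicator_expectation_eqI_real)
    fix t
    have "(CLINT x|M. Re (h x) * iexp (t * X x))
        = ((CLINT x|M. h x * iexp (t * X x)) + (CLINT x|M. cnj (h x) * iexp (t * X x))) / 2"
      using iM[of t] by (simp add: Re distrib_right add_divide_distrib del: of_real_mult)
    also have "\<dots> = ((CLINT x|N. h' x * iexp (t * Y x)) + (CLINT x|N. cnj (h' x) * iexp (t * Y x))) / 2"
      by (simp only: eq eqc)
    also have "\<dots> = (CLINT x|N. Re (h' x) * iexp (t * Y x))"
      using iN[of t] by (simp add: Re distrib_right add_divide_distrib del: of_real_mult)
    finally show "(CLINT x|M. Re (h x) * iexp (t * X x)) = (CLINT x|N. Re (h' x) * iexp (t * Y x))" .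
    show "\<bar>Re (h x)\<bar> \<le> 1" "\<bar>Re (h' y)\<bar> \<le> 1" for x y
      using abs_Re_le_cmod order_trans b by blast+
  qed (use assms(1,2) eq1 in \<open>simp_all del: of_real_mult\<close>)
  moreover have "(\<integral>x. Im (h x) * indicator B (X x) \<partial>M) = (\<integral>y. Im (h' y) * indicator B (Y y) \<partial>N)"
  proof (rule indicator_expectation_eqI_real)
    fix t
    define c where "c = \<i> / 2"
    have "(CLINT x|M. Im (h x) * iexp (t * X x))
        = c * (CLINT x|M. cnj (h x) * iexp (t * X x)) - c * (CLINT x|M. h x * iexp (t * X x))"
      using iM[of t] by (simp add: Im[OF c_def] left_diff_distrib mult.assoc del: of_real_mult)
    also have "\<dots> = c * (CLINT x|N. cnj (h' x) * iexp (t * Y x)) - c * (CLINT x|N. h' x * iexp (t * Y x))"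
      by (simp only: eq eqc)
    also have "\<dots> = (CLINT x|N. Im (h' x) * iexp (t * Y x))"
      using iN[of t] by (simp add: Im[OF c_def] left_diff_distrib mult.assoc del: of_real_mult)
    finally show "(CLINT x|M. Im (h x) * iexp (t * X x)) = (CLINT x|N. Im (h' x) * iexp (t * Y x))" .
    show "\<bar>Im (h x)\<bar> \<le> 1" "\<bar>Im (h' y)\<bar> \<le> 1" for x y
      using abs_Im_le_cmod order_trans b by blast+
  qed (use assms(1,2) eq1 in \<open>simp_all del: of_real_mult\<close>)
  moreover have "Re (z * indicator B u) = Re z * indicator B u" "Im (z * indicator B u) = Im z * indicator B u" for z u
    by (simp_all add: indicator_def)
  ultimately show ?thesis
    using iMB iNB by (simp add: complex_eq_iff flip: integral_Re integral_Im del: Re_complex_of_real times_complex.sel)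
qed

text \<open>The exponential factors are exchanged for indicators one coordinate at a time: \<open>J\<close> is the set of
  coordinates already treated. The exponential keeps running over all of \<open>I\<close>, so that
  the induction hypothesis with one shifted frequency is the hypothesis of the weighted
  one-dimensional statement.\<close>

lemma box_expectation_eqI:
  fixes X :: "'i \<Rightarrow> 'a \<Rightarrow> real" and Y :: "'i \<Rightarrow> 'b \<Rightarrow> real"
  assumes "prob_space M" "prob_space N" and fin: "finite I"
    and [measurable]: "\<And>i. i \<in> I \<Longrightarrow> X i \<in> borel_measurable M" "\<And>i. i \<in> I \<Longrightarrow> Y i \<in> borel_measurable N"
    and eq: "\<And>t. (CLINT x|M. iexp (\<Sum>i\<in>I. t i * X i x)) = (CLINT y|N. iexp (\<Sum>i\<in>I. t i * Y i y))"
    and B: "\<And>i. i \<in> I \<Longrightarrow> B i \<in> sets borel"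
    and "J \<subseteq> I"
  shows "(CLINT x|M. (\<Prod>j\<in>J. indicator (B j) (X j x)) * iexp (\<Sum>i\<in>I. t i * X i x))
       = (CLINT y|N. (\<Prod>j\<in>J. indicator (B j) (Y j y)) * iexp (\<Sum>i\<in>I. t i * Y i y))"
proof -
  note [measurable] = B
  have "finite J" using \<open>J \<subseteq> I\<close> fin by (rule finite_subset)
  then show ?thesis
    using \<open>J \<subseteq> I\<close>
  proof (induction J arbitrary: t)
    case empty
    show ?case using eq[of t] by simp
  next
    case (insert k J)
    then have k: "k \<in> I" and J: "\<And>j. j \<in> J \<Longrightarrow> j \<in> I" by auto
    have shift: "(\<Sum>i\<in>I. (t(k := t k + s)) i * f i) = (\<Sum>i\<in>I. t i * f i) + s * f k" for t :: "'i \<Rightarrow> real" and f s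
    proof -
      have "(\<Sum>i\<in>I. (t(k := t k + s)) i * f i) = (\<Sum>i\<in>I. t i * f i + (if i = k then s * f k else 0))"
        by (intro sum.cong) (auto simp: algebra_simps)
      then show ?thesis using k fin by (simp add: sum.distrib)
    qed
    have single: "(\<Sum>i\<in>I. ((\<lambda>_. 0)(k := s)) i * f i) = s * f k" for f :: "'i \<Rightarrow> real" and s
      using shift[of "\<lambda>_. 0" s f] by (simp del: fun_upd_apply)
    have bound: "cmod ((\<Prod>j\<in>J. indicator (B j) (f j)) * iexp u) \<le> 1" for f :: "'i \<Rightarrow> real" and u
      by (auto simp: norm_mult prod_norm[symmetric] indicator_def intro!: prod_le_1)
    have "(CLINT x|M. ((\<Prod>j\<in>J. indicator (B j) (X j x)) * iexp (\<Sum>i\<in>I. t i * X i x)) * indicator (B k) (X k x))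
       = (CLINT y|N. ((\<Prod>j\<in>J. indicator (B j) (Y j y)) * iexp (\<Sum>i\<in>I. t i * Y i y)) * indicator (B k) (Y k y))"
    proof (rule indicator_expectation_eqI)
      show "(CLINT x|M. iexp (s * X k x)) = (CLINT y|N. iexp (s * Y k y))" for s
        using eq[of "(\<lambda>_. 0)(k := s)"] unfolding single .
      show "(CLINT x|M. ((\<Prod>j\<in>J. indicator (B j) (X j x)) * iexp (\<Sum>i\<in>I. t i * X i x)) * iexp (s * X k x))
          = (CLINT y|N. ((\<Prod>j\<in>J. indicator (B j) (Y j y)) * iexp (\<Sum>i\<in>I. t i * Y i y)) * iexp (s * Y k y))" for s
        using insert.IH[of "t(k := t k + s)"] insert.prems unfolding shift[where t = t and s = s]
        by (simp add: distrib_left exp_add mult.assoc)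
      show "(\<lambda>x. (\<Prod>j\<in>J. indicator (B j) (X j x)) * iexp (\<Sum>i\<in>I. t i * X i x)) \<in> borel_measurable M"
        "(\<lambda>y. (\<Prod>j\<in>J. indicator (B j) (Y j y)) * iexp (\<Sum>i\<in>I. t i * Y i y)) \<in> borel_measurable N"
        using J by measurable
      show "cmod ((\<Prod>j\<in>J. indicator (B j) (X j x)) * iexp (\<Sum>i\<in>I. t i * X i x)) \<le> 1"
        "cmod ((\<Prod>j\<in>J. indicator (B j) (Y j y)) * iexp (\<Sum>i\<in>I. t i * Y i y)) \<le> 1" for x y
        by (rule bound)+
    qed (use assms(1,2) k B in simp_all)
    then show ?case
      using insert.hyps by (simp add: mult_ac)
  qed
qed

lemma integral_complex_indicator:
  assumes "S \<in> sets M"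
  shows "(CLINT x|M. indicator S x) = complex_of_real (measure M S)"
proof -
  have "(CLINT x|M. indicator S x) = (CLINT x|M. complex_of_real (indicator S x))"
    by (intro Bochner_Integration.integral_cong) (auto simp: indicator_def)
  also have "\<dots> = complex_of_real (\<integral>x. indicator S x \<partial>M)"
    by (rule integral_complex_of_real)
  finally show ?thesis
    using assms by (simp add: Int_absorb2 sets.sets_into_space)
qed

text \<open>The characteristic function determines the joint law of finitely many real random variables: by
  \<open>box_expectation_eqI\<close> with \<open>J = I\<close> and zero frequencies the laws agree on boxes, which form
  a generator closed under intersections.\<close>

lemma distr_PiM_eqI_char:
  fixes X :: "'i \<Rightarrow> 'a \<Rightarrow> real" and Y :: "'i \<Rightarrow> 'b \<Rightarrow> real"
  assumes "prob_space M" "prob_space N" and fin: "finite I"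
    and [measurable]: "\<And>i. i \<in> I \<Longrightarrow> X i \<in> borel_measurable M" "\<And>i. i \<in> I \<Longrightarrow> Y i \<in> borel_measurable N"
    and eq: "\<And>t. (CLINT x|M. iexp (\<Sum>i\<in>I. t i * X i x)) = (CLINT y|N. iexp (\<Sum>i\<in>I. t i * Y i y))"
  shows "distr M (\<Pi>\<^sub>M i\<in>I. borel) (\<lambda>x. \<lambda>i\<in>I. X i x) = distr N (\<Pi>\<^sub>M i\<in>I. borel) (\<lambda>y. \<lambda>i\<in>I. Y i y)"
    (is "?P = ?Q")
proof -
  interpret M: prob_space M by fact
  interpret N: prob_space N by fact
  interpret P: prob_space ?P by (rule M.prob_space_distr) measurable
  have box: "?P (Pi\<^sub>E I A) = ?Q (Pi\<^sub>E I A)" if A: "\<And>i. i \<in> I \<Longrightarrow> A i \<in> sets borel" for A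
  proof -
    note [measurable] = A
    have pr: "(\<Prod>j\<in>I. indicator (A j) (f j)) = (indicator {f. \<forall>i\<in>I. f i \<in> A i} f :: complex)" for f :: "'i \<Rightarrow> real"
      using fin by (auto simp: indicator_def)
    have "complex_of_real (measure M {x \<in> space M. \<forall>i\<in>I. X i x \<in> A i})
        = (CLINT x|M. indicator {x \<in> space M. \<forall>i\<in>I. X i x \<in> A i} x)"
      using fin by (subst integral_complex_indicator) auto
    also have "\<dots> = (CLINT x|M. (\<Prod>j\<in>I. indicator (A j) (X j x)) * iexp (\<Sum>i\<in>I. 0 * X i x))"
      unfolding pr by (intro Bochner_Integration.integral_cong) (auto simp: indicator_def)
    also have "\<dots> = (CLINT x|N. (\<Prod>j\<in>I. indicator (A j) (Y j x)) * iexp (\<Sum>i\<in>I. 0 * Y i x))"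
      by (rule box_expectation_eqI[where t = "\<lambda>_. 0"]) (use assms A in auto)
    also have "\<dots> = (CLINT x|N. indicator {x \<in> space N. \<forall>i\<in>I. Y i x \<in> A i} x)"
      unfolding pr by (intro Bochner_Integration.integral_cong) (auto simp: indicator_def)
    also have "\<dots> = measure N {x \<in> space N. \<forall>i\<in>I. Y i x \<in> A i}"
      using fin by (subst integral_complex_indicator) auto
    finally have *: "measure M {x \<in> space M. \<forall>i\<in>I. X i x \<in> A i} = measure N {x \<in> space N. \<forall>i\<in>I. Y i x \<in> A i}"
      by simp
    have "?P (Pi\<^sub>E I A) = emeasure M {x \<in> space M. \<forall>i\<in>I. X i x \<in> A i}"
      using fin by (subst emeasure_distr) (auto intro!: arg_cong[where f = "emeasure M"] sets_PiM_I_finite)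
    moreover have "?Q (Pi\<^sub>E I A) = emeasure N {x \<in> space N. \<forall>i\<in>I. Y i x \<in> A i}"
      using fin by (subst emeasure_distr) (auto intro!: arg_cong[where f = "emeasure N"] sets_PiM_I_finite)
    ultimately show ?thesis
      using * by (simp add: M.emeasure_eq_measure N.emeasure_eq_measure)
  qed
  show ?thesis
  proof (rule measure_eqI_PiM_finite[OF fin _ _ box])
    show "range (\<lambda>_::nat. \<Pi>\<^sub>E i\<in>I. UNIV) \<subseteq> prod_algebra I (\<lambda>_. borel)"
      using fin by (auto intro!: prod_algebraI_finite)
    show "(\<Union>i::nat. \<Pi>\<^sub>E i\<in>I. UNIV) = space (\<Pi>\<^sub>M i\<in>I. (borel :: real measure))"
      by (simp add: space_PiM)
    show "?P (\<Pi>\<^sub>E i\<in>I. UNIV) \<noteq> \<infinity>"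
      using P.emeasure_finite by (simp only: infinity_ennreal_def not_False_eq_True simp_thms)
  qed simp_all
qed


section \<open>Linear spaces of centered Gaussian variables\<close>

text \<open>Stated through the characteristic function, which includes the degenerate law at 0 and passes to
  limits.\<close>

definition centered_gaussian :: "'a measure \<Rightarrow> ('a \<Rightarrow> real) \<Rightarrow> bool" where
  "centered_gaussian M X \<longleftrightarrow> X \<in> borel_measurable M \<and> integrable M (\<lambda>\<omega>. (X \<omega>)\<^sup>2) \<and>
     (\<forall>t. (CLINT \<omega>|M. iexp (t * X \<omega>)) = complex_of_real (exp (- (t\<^sup>2 * (\<integral>\<omega>. (X \<omega>)\<^sup>2 \<partial>M)) / 2)))"

text \<open>The parameter \<open>v\<close> is automatically the second moment, because the law is that of
  \<open>\<surd>v\<close> times a standard normal variable.\<close>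

lemma centered_gaussianI:
  assumes "prob_space M" and [measurable]: "X \<in> borel_measurable M" and "0 \<le> v"
    and char: "\<And>t. (CLINT \<omega>|M. iexp (t * X \<omega>)) = complex_of_real (exp (- (t\<^sup>2 * v) / 2))"
  shows "centered_gaussian M X"
proof -
  interpret prob_space M by fact
  interpret N: real_distribution std_normal_distribution by (rule real_dist_normal_dist)
  have eq: "distr M borel X = distr std_normal_distribution borel (\<lambda>x. sqrt v * x)"
  proof (rule Levy_uniqueness)
    show "real_distribution (distr M borel X)"
      by simp
    show "real_distribution (distr std_normal_distribution borel (\<lambda>x. sqrt v * x))"
      by (intro N.real_distribution_distr) simp
    show "char (distr M borel X) = char (distr std_normal_distribution borel (\<lambda>x. sqrt v * x))"
    proof
      fix t
      have "char (distr std_normal_distribution borel (\<lambda>x. sqrt v * x)) t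
          = char std_normal_distribution (t * sqrt v)"
        unfolding char_def by (subst integral_distr) (auto simp: mult.assoc)
      also have "\<dots> = char (distr M borel X) t"
        using char[of t] \<open>0 \<le> v\<close>
        by (subst char_std_normal_distribution) (simp add: char_def integral_distr power_mult_distrib)
      finally show "char (distr M borel X) t = char (distr std_normal_distribution borel (\<lambda>x. sqrt v * x)) t"
        by simp
    qed
  qed
  have sq: "integrable std_normal_distribution (\<lambda>x. (sqrt v * x)\<^sup>2)"
    using integrable_std_normal_distribution_moment[of 2] by (simp add: power_mult_distrib)
  have "integrable (distr M borel X) (\<lambda>x. x\<^sup>2)"
    unfolding eq by (subst integrable_distr_eq) (use sq in auto)
  then have int: "integrable M (\<lambda>\<omega>. (X \<omega>)\<^sup>2)"
    by (subst (asm) integrable_distr_eq) auto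
  have "(\<integral>\<omega>. (X \<omega>)\<^sup>2 \<partial>M) = (\<integral>x. x\<^sup>2 \<partial>distr M borel X)"
    by (subst integral_distr) auto
  also have "\<dots> = (\<integral>x. (sqrt v * x)\<^sup>2 \<partial>std_normal_distribution)"
    unfolding eq by (subst integral_distr) auto
  also have "\<dots> = v"
    using \<open>0 \<le> v\<close> std_normal_distribution_even_moments(1)[of 1]
    by (simp add: power_mult_distrib fact_numeral)
  finally show ?thesis
    using int char by (simp add: centered_gaussian_def)
qed

lemma centered_gaussian_if_gaussian_rv:
  assumes "prob_space M" and Z: "gaussian_rv M Z"
  shows "integrable M Z" "centered_gaussian M (\<lambda>\<omega>. Z \<omega> - (\<integral>\<omega>. Z \<omega> \<partial>M))"
proof -
  interpret prob_space M by fact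
  have [measurable]: "Z \<in> borel_measurable M"
    using Z by (simp add: gaussian_rv_def)
  have "integrable M Z \<and> centered_gaussian M (\<lambda>\<omega>. Z \<omega> - (\<integral>\<omega>. Z \<omega> \<partial>M))"
    using Z unfolding gaussian_rv_def
  proof safe
    fix \<mu> :: real
    assume ae: "AE \<omega> in M. Z \<omega> = \<mu>"
    show "integrable M Z"
      by (subst integrable_cong_AE[where g = "\<lambda>_. \<mu>"]) (use ae in auto)
    have mean: "(\<integral>\<omega>. Z \<omega> \<partial>M) = \<mu>"
      by (subst integral_cong_AE[where g = "\<lambda>_. \<mu>"]) (use ae in \<open>auto simp: prob_space\<close>)
    show "centered_gaussian M (\<lambda>\<omega>. Z \<omega> - (\<integral>\<omega>. Z \<omega> \<partial>M))"
    proof (rule centered_gaussianI[where v = 0])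
      fix t :: real
      have "(CLINT \<omega>|M. iexp (t * (Z \<omega> - (\<integral>\<omega>. Z \<omega> \<partial>M)))) = (CLINT \<omega>|M. 1)"
        by (rule integral_cong_AE) (use ae mean in auto)
      then show "(CLINT \<omega>|M. iexp (t * (Z \<omega> - (\<integral>\<omega>. Z \<omega> \<partial>M)))) = complex_of_real (exp (- (t\<^sup>2 * 0) / 2))"
        by (simp add: prob_space)
    qed (use assms(1) in auto)
  next
    fix \<mu> \<sigma> :: real
    assume \<sigma>: "0 < \<sigma>" and D: "distributed M lborel Z (\<lambda>x. ennreal (normal_density \<mu> \<sigma> x))"
    have mean: "(\<integral>\<omega>. Z \<omega> \<partial>M) = \<mu>"
      by (rule normal_distributed_expectation[OF \<sigma> D])
    show "integrable M Z"
      by (rule distributed_integrable_var[OF D]) (use \<sigma> integrable_normal_moment_nz_1 in auto)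
    have "distributed M lborel (\<lambda>x. - \<mu> / \<sigma> + (1 / \<sigma>) * Z x)
        (\<lambda>x. ennreal (normal_density (- \<mu> / \<sigma> + (1 / \<sigma>) * \<mu>) (\<bar>1 / \<sigma>\<bar> * \<sigma>) x))"
      by (rule normal_density_affine[OF D]) (use \<sigma> in auto)
    then have D1: "distributed M lborel (\<lambda>x. - \<mu> / \<sigma> + (1 / \<sigma>) * Z x) std_normal_density"
      using \<sigma> by simp
    have std: "distr M lborel (\<lambda>x. - \<mu> / \<sigma> + (1 / \<sigma>) * Z x) = std_normal_distribution"
      by (rule distributed_distr_eq_density[OF D1])
    show "centered_gaussian M (\<lambda>\<omega>. Z \<omega> - (\<integral>\<omega>. Z \<omega> \<partial>M))"
    proof (rule centered_gaussianI[where v = "\<sigma>\<^sup>2"])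
      fix t :: real
      have "char std_normal_distribution (t * \<sigma>) = (CLINT \<omega>|M. iexp (t * \<sigma> * (- \<mu> / \<sigma> + (1 / \<sigma>) * Z \<omega>)))"
        unfolding std[symmetric] char_def by (subst integral_distr) auto
      also have "\<dots> = (CLINT \<omega>|M. iexp (t * (Z \<omega> - (\<integral>\<omega>. Z \<omega> \<partial>M))))"
      proof -
        have "t * \<sigma> * (- \<mu> / \<sigma> + (1 / \<sigma>) * Z \<omega>) = t * (Z \<omega> - (\<integral>\<omega>. Z \<omega> \<partial>M))" for \<omega>
          unfolding mean using \<sigma> by (simp add: field_simps)
        then show ?thesis by (simp only:)
      qed
      finally show "(CLINT \<omega>|M. iexp (t * (Z \<omega> - (\<integral>\<omega>. Z \<omega> \<partial>M)))) = complex_of_real (exp (- (t\<^sup>2 * \<sigma>\<^sup>2) / 2))"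
        by (simp add: char_std_normal_distribution power_mult_distrib)
    qed (use assms(1) in auto)
  qed
  then show "integrable M Z" "centered_gaussian M (\<lambda>\<omega>. Z \<omega> - (\<integral>\<omega>. Z \<omega> \<partial>M))"
    by auto
qed

text \<open>By dominated convergence the characteristic functions \<open>exp (-t\<^sup>2 v\<^sub>n / 2)\<close> converge to that of the
  limit. The latter is nonzero at some \<open>t\<^sub>0 \<noteq> 0\<close>, by continuity at 0; taking logarithms there shows
  that the variances \<open>v\<^sub>n\<close> converge, so the limit is of Gaussian form again.\<close>

lemma centered_gaussian_AE_limit:
  fixes X :: "nat \<Rightarrow> 'a \<Rightarrow> real"
  assumes "prob_space M" and X: "\<And>n. centered_gaussian M (X n)"
    and [measurable]: "Y \<in> borel_measurable M"
    and lim: "AE \<omega> in M. (\<lambda>n. X n \<omega>) \<longlonglongrightarrow> Y \<omega>"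
  shows "centered_gaussian M Y"
proof -
  interpret prob_space M by fact
  interpret Y: real_distribution "distr M borel Y" by simp
  have [measurable]: "X n \<in> borel_measurable M" for n
    using X by (simp add: centered_gaussian_def)
  define v where "v n = (\<integral>\<omega>. (X n \<omega>)\<^sup>2 \<partial>M)" for n
  have v0: "0 \<le> v n" for n
    by (simp add: v_def)
  define \<phi> where "\<phi> t = (CLINT \<omega>|M. iexp (t * Y \<omega>))" for t
  have \<phi>: "char (distr M borel Y) = \<phi>"
    by (auto simp: \<phi>_def char_def integral_distr)
  have lim\<phi>: "(\<lambda>n. complex_of_real (exp (- (t\<^sup>2 * v n) / 2))) \<longlonglongrightarrow> \<phi> t" for t
  proof -
    have "(\<lambda>n. CLINT \<omega>|M. iexp (t * X n \<omega>)) \<longlonglongrightarrow> \<phi> t"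
      unfolding \<phi>_def
    proof (rule integral_dominated_convergence[where w = "\<lambda>_. 1"])
      show "AE \<omega> in M. (\<lambda>n. iexp (t * X n \<omega>)) \<longlonglongrightarrow> iexp (t * Y \<omega>)"
        using lim by eventually_elim (intro tendsto_intros)
    qed (auto simp del: of_real_mult)
    then show ?thesis
      using X by (simp add: centered_gaussian_def v_def)
  qed
  obtain t0 where t0: "t0 > 0" "\<phi> t0 \<noteq> 0"
  proof -
    have "\<phi> 0 = 1" using Y.char_zero \<phi> by simp
    moreover have "isCont \<phi> 0" using Y.isCont_char[of 0] \<phi> by simp
    ultimately have "\<forall>\<^sub>F t in at 0. \<phi> t \<noteq> 0"
      by (intro tendsto_imp_eventually_ne[where c = 1]) (auto simp: isCont_def)
    then obtain d where "d > 0" "\<And>t. t \<noteq> 0 \<Longrightarrow> dist t 0 < d \<Longrightarrow> \<phi> t \<noteq> 0"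
      by (auto simp: eventually_at)
    then show ?thesis by (intro that[of "d/2"]) auto
  qed
  have "(\<lambda>n. cmod (complex_of_real (exp (- (t0\<^sup>2 * v n) / 2)))) \<longlonglongrightarrow> cmod (\<phi> t0)"
    by (intro tendsto_norm lim\<phi>)
  then have "(\<lambda>n. exp (- (t0\<^sup>2 * v n) / 2)) \<longlonglongrightarrow> cmod (\<phi> t0)"
    by simp
  then have "(\<lambda>n. ln (exp (- (t0\<^sup>2 * v n) / 2))) \<longlonglongrightarrow> ln (cmod (\<phi> t0))"
    by (rule tendsto_ln) (use t0 in auto)
  then have "(\<lambda>n. (- 2 / t0\<^sup>2) * ln (exp (- (t0\<^sup>2 * v n) / 2))) \<longlonglongrightarrow> (- 2 / t0\<^sup>2) * ln (cmod (\<phi> t0))"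
    by (rule tendsto_mult_left)
  then obtain w where w: "v \<longlonglongrightarrow> w"
    using t0 by (auto simp: field_simps)
  show ?thesis
  proof (rule centered_gaussianI)
    show "0 \<le> w"
      by (rule LIMSEQ_le_const[OF w]) (use v0 in auto)
    fix t
    have "(\<lambda>n. complex_of_real (exp (- (t\<^sup>2 * v n) / 2))) \<longlonglongrightarrow> complex_of_real (exp (- (t\<^sup>2 * w) / 2))"
      by (intro tendsto_intros w) auto
    then show "(CLINT \<omega>|M. iexp (t * Y \<omega>)) = complex_of_real (exp (- (t\<^sup>2 * w) / 2))"
      using LIMSEQ_unique[OF _ lim\<phi>[of t]] by (simp add: \<phi>_def)
  qed (use assms(1) in auto)
qed

text \<open>Linearity of the space is what encodes joint Gaussianity: all linear combinations of its members
  are again centered Gaussian.\<close>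

definition gaussian_space :: "'a measure \<Rightarrow> ('a \<Rightarrow> real) set \<Rightarrow> bool" where
  "gaussian_space M S \<longleftrightarrow> (\<forall>X\<in>S. centered_gaussian M X) \<and> (\<lambda>_. 0) \<in> S \<and>
     (\<forall>X\<in>S. \<forall>Y\<in>S. \<forall>a b. (\<lambda>\<omega>. a * X \<omega> + b * Y \<omega>) \<in> S)"

definition AE_closure :: "'a measure \<Rightarrow> ('a \<Rightarrow> real) set \<Rightarrow> ('a \<Rightarrow> real) set" where
  "AE_closure M S = {Y \<in> borel_measurable M. \<exists>X. (\<forall>n::nat. X n \<in> S) \<and> (AE \<omega> in M. (\<lambda>n. X n \<omega>) \<longlonglongrightarrow> Y \<omega>)}"

lemma gaussian_space_AE_closure:
  assumes "prob_space M" and S: "gaussian_space M S"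
  shows "gaussian_space M (AE_closure M S)"
  unfolding gaussian_space_def
proof (intro conjI ballI allI)
  fix X assume "X \<in> AE_closure M S"
  then show "centered_gaussian M X"
    using S by (auto simp: AE_closure_def gaussian_space_def intro: centered_gaussian_AE_limit[OF assms(1)])
next
  show "(\<lambda>_. 0) \<in> AE_closure M S"
    using S by (auto simp: AE_closure_def gaussian_space_def intro!: exI[of _ "\<lambda>_ _. 0"])
next
  fix X Y :: "'a \<Rightarrow> real" and a b :: real
  assume "X \<in> AE_closure M S" "Y \<in> AE_closure M S"
  then obtain Xn Yn where [measurable]: "X \<in> borel_measurable M" "Y \<in> borel_measurable M"
    and *: "\<And>n::nat. Xn n \<in> S" "\<And>n::nat. Yn n \<in> S"
    and lim: "AE \<omega> in M. (\<lambda>n. Xn n \<omega>) \<longlonglongrightarrow> X \<omega>" "AE \<omega> in M. (\<lambda>n. Yn n \<omega>) \<longlonglongrightarrow> Y \<omega>"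
    by (auto simp: AE_closure_def)
  have "AE \<omega> in M. (\<lambda>n. a * Xn n \<omega> + b * Yn n \<omega>) \<longlonglongrightarrow> a * X \<omega> + b * Y \<omega>"
    using lim by eventually_elim (intro tendsto_intros)
  moreover have "\<And>n. (\<lambda>\<omega>. a * Xn n \<omega> + b * Yn n \<omega>) \<in> S"
    using S * by (auto simp: gaussian_space_def)
  ultimately show "(\<lambda>\<omega>. a * X \<omega> + b * Y \<omega>) \<in> AE_closure M S"
    unfolding AE_closure_def by (auto intro!: exI[of _ "\<lambda>n \<omega>. a * Xn n \<omega> + b * Yn n \<omega>"])
qed

lemma gaussian_space_sum:
  assumes "gaussian_space M S" "finite I" "\<And>i. i \<in> I \<Longrightarrow> X i \<in> S"
  shows "(\<lambda>\<omega>. \<Sum>i\<in>I. c i * X i \<omega>) \<in> S"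
  using assms(2,3)
proof (induction I)
  case empty
  then show ?case using assms(1) by (simp add: gaussian_space_def)
next
  case (insert k I)
  have comb: "X \<in> S \<Longrightarrow> Y \<in> S \<Longrightarrow> (\<lambda>\<omega>. a * X \<omega> + b * Y \<omega>) \<in> S" for X Y a b
    using assms(1) by (auto simp: gaussian_space_def)
  show ?case
    using comb[of "X k" "\<lambda>\<omega>. \<Sum>i\<in>I. c i * X i \<omega>" "c k" 1] insert by simp
qed

lemma gaussian_space_gaussian_process:
  assumes "prob_space M" and V: "gaussian_process M V"
  shows "gaussian_space M {\<lambda>\<omega>. \<Sum>i\<in>I. c i * (V i \<omega> - (\<integral>\<omega>. V i \<omega> \<partial>M)) | I c. finite I}"
    (is "gaussian_space M ?S")
proof -
  interpret prob_space M by fact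
  have gauss: "gaussian_rv M (\<lambda>\<omega>. \<Sum>i\<in>I. c i * V i \<omega>)" if "finite I" for I c
    using V that by (simp add: gaussian_process_def multivariate_gaussian_def)
  have int: "integrable M (V i)" for i
    using centered_gaussian_if_gaussian_rv(1)[OF assms(1) gauss[of "{i}" "\<lambda>_. 1"]] by simp
  have cg: "centered_gaussian M (\<lambda>\<omega>. \<Sum>i\<in>I. c i * (V i \<omega> - (\<integral>\<omega>. V i \<omega> \<partial>M)))" if "finite I" for I c
  proof -
    have "(\<lambda>\<omega>. (\<Sum>i\<in>I. c i * V i \<omega>) - (\<integral>\<omega>. (\<Sum>i\<in>I. c i * V i \<omega>) \<partial>M))
        = (\<lambda>\<omega>. \<Sum>i\<in>I. c i * (V i \<omega> - (\<integral>\<omega>. V i \<omega> \<partial>M)))"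
      using int by (simp add: sum_subtractf right_diff_distrib)
    then show ?thesis
      using centered_gaussian_if_gaussian_rv(2)[OF assms(1) gauss[OF that, of c]] by simp
  qed
  show ?thesis
    unfolding gaussian_space_def
  proof (intro conjI ballI allI)
    show "centered_gaussian M X" if "X \<in> ?S" for X
      using that cg by auto
    show "(\<lambda>_. 0) \<in> ?S"
      by (auto intro!: exI[of _ "{}"])
    fix X Y a b assume "X \<in> ?S" "Y \<in> ?S"
    then obtain I J c d where fin: "finite I" "finite J"
      and X: "X = (\<lambda>\<omega>. \<Sum>i\<in>I. c i * (V i \<omega> - (\<integral>\<omega>. V i \<omega> \<partial>M)))"
      and Y: "Y = (\<lambda>\<omega>. \<Sum>i\<in>J. d i * (V i \<omega> - (\<integral>\<omega>. V i \<omega> \<partial>M)))"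
      by auto
    define e where "e i = a * (if i \<in> I then c i else 0) + b * (if i \<in> J then d i else 0)" for i
    have "(\<Sum>i\<in>I \<union> J. e i * f i) = a * (\<Sum>i\<in>I. c i * f i) + b * (\<Sum>i\<in>J. d i * f i)" for f :: "'b \<Rightarrow> real"
    proof -
      have "(\<Sum>i\<in>I. c i * f i) = (\<Sum>i\<in>I \<union> J. (if i \<in> I then c i else 0) * f i)"
        using fin by (intro sum.mono_neutral_cong_left) auto
      moreover have "(\<Sum>i\<in>J. d i * f i) = (\<Sum>i\<in>I \<union> J. (if i \<in> J then d i else 0) * f i)"
        using fin by (intro sum.mono_neutral_cong_left) auto
      ultimately show ?thesis
        by (simp add: e_def distrib_right sum.distrib sum_distrib_left mult.assoc)
    qed
    then have "(\<lambda>\<omega>. a * X \<omega> + b * Y \<omega>) = (\<lambda>\<omega>. \<Sum>i\<in>I \<union> J. e i * (V i \<omega> - (\<integral>\<omega>. V i \<omega> \<partial>M)))"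
      by (simp add: X Y)
    then show "(\<lambda>\<omega>. a * X \<omega> + b * Y \<omega>) \<in> ?S"
      using fin by (auto intro!: exI[of _ "I \<union> J"] exI[of _ e])
  qed
qed


section \<open>Fernique's theorem\<close>

lemma integral_pair_measure_mult:
  fixes f :: "'a \<Rightarrow> 'c::{real_normed_field, banach, second_countable_topology}"
  assumes "prob_space M" "prob_space N" and f: "integrable M f" and g: "integrable N g"
  shows "integrable (M \<Otimes>\<^sub>M N) (\<lambda>p. f (fst p) * g (snd p))"
    and "(\<integral>p. f (fst p) * g (snd p) \<partial>(M \<Otimes>\<^sub>M N)) = (\<integral>x. f x \<partial>M) * (\<integral>y. g y \<partial>N)"
proof -
  interpret M: prob_space M by fact
  interpret N: prob_space N by fact
  interpret pair_sigma_finite M N ..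
  have [measurable]: "f \<in> borel_measurable M" "g \<in> borel_measurable N"
    using f g by auto
  show int: "integrable (M \<Otimes>\<^sub>M N) (\<lambda>p. f (fst p) * g (snd p))"
    by (rule Fubini_integrable) (use f g in \<open>auto simp: norm_mult\<close>)
  show "(\<integral>p. f (fst p) * g (snd p) \<partial>(M \<Otimes>\<^sub>M N)) = (\<integral>x. f x \<partial>M) * (\<integral>y. g y \<partial>N)"
    using integral_fst'[OF int] by simp
qed

lemma char_pair_centered_gaussian:
  assumes "prob_space M" and F: "centered_gaussian M F" and G: "centered_gaussian M G"
  shows "(CLINT p|M \<Otimes>\<^sub>M M. iexp (F (fst p) + G (snd p)))
    = complex_of_real (exp (- ((\<integral>\<omega>. (F \<omega>)\<^sup>2 \<partial>M) + (\<integral>\<omega>. (G \<omega>)\<^sup>2 \<partial>M)) / 2))"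
proof -
  interpret prob_space M by fact
  have [measurable]: "F \<in> borel_measurable M" "G \<in> borel_measurable M"
    using F G by (auto simp: centered_gaussian_def)
  have "(CLINT p|M \<Otimes>\<^sub>M M. iexp (F (fst p) + G (snd p))) = (CLINT p|M \<Otimes>\<^sub>M M. iexp (F (fst p)) * iexp (G (snd p)))"
    by (simp add: distrib_left exp_add)
  also have "\<dots> = (CLINT \<omega>|M. iexp (F \<omega>)) * (CLINT \<omega>|M. iexp (G \<omega>))"
    by (rule integral_pair_measure_mult[OF assms(1,1)]) (auto intro!: integrable_iexp)
  also have "\<dots> = complex_of_real (exp (- (\<integral>\<omega>. (F \<omega>)\<^sup>2 \<partial>M) / 2)) * complex_of_real (exp (- (\<integral>\<omega>. (G \<omega>)\<^sup>2 \<partial>M) / 2))"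
  proof -
    have "(CLINT \<omega>|M. iexp (H \<omega>)) = complex_of_real (exp (- (\<integral>\<omega>. (H \<omega>)\<^sup>2 \<partial>M) / 2))" if "centered_gaussian M H" for H
      using that[unfolded centered_gaussian_def, THEN conjunct2, THEN conjunct2, rule_format, of 1] by simp
    then show ?thesis using F G by simp
  qed
  also have "\<dots> = complex_of_real (exp (- ((\<integral>\<omega>. (F \<omega>)\<^sup>2 \<partial>M) + (\<integral>\<omega>. (G \<omega>)\<^sup>2 \<partial>M)) / 2))"
    by (simp only: of_real_mult[symmetric] exp_add[symmetric]) (simp add: field_simps)
  finally show ?thesis .
qed

text \<open>The rotated pair \<open>((X - Y) / \<surd>2, (X + Y) / \<surd>2)\<close> has the law of the independent pair \<open>(X, Y)\<close>; the
  Boolean index selects the component of the pair. For linear forms \<open>A\<close> and \<open>B\<close>, the combination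
  \<open>A((X - Y) / \<surd>2) + B((X + Y) / \<surd>2)\<close> equals \<open>F(X) + G(Y)\<close> with \<open>F = (A + B) / \<surd>2\<close> and \<open>G = (B - A) / \<surd>2\<close>.
  Its characteristic function depends only on \<open>E F\<^sup>2 + E G\<^sup>2\<close>, which equals \<open>E A\<^sup>2 + E B\<^sup>2\<close>.\<close>

lemma rotation_invariance:
  assumes "prob_space M" and S: "gaussian_space M S" and fin: "finite I" and X: "\<And>i. i \<in> I \<Longrightarrow> X i \<in> S"
  shows "distr (M \<Otimes>\<^sub>M M) (\<Pi>\<^sub>M j\<in>UNIV \<times> I. borel) (\<lambda>p. \<lambda>(b, i)\<in>UNIV \<times> I.
        (if b then X i (fst p) + X i (snd p) else X i (fst p) - X i (snd p)) / sqrt 2)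
    = distr (M \<Otimes>\<^sub>M M) (\<Pi>\<^sub>M j\<in>UNIV \<times> I. borel) (\<lambda>p. \<lambda>(b, i)\<in>UNIV \<times> I. X i (if b then snd p else fst p))"
proof -
  let ?Z = "\<lambda>p (b, i). (if b then X i (fst p) + X i (snd p) else X i (fst p) - X i (snd p)) / sqrt 2"
  let ?W = "\<lambda>p (b, i). X i (if b then snd p else fst p)"
  interpret prob_space M by fact
  interpret P: pair_prob_space M M ..
  have mX [measurable]: "X i \<in> borel_measurable M" if "i \<in> I" for i
    using S X[OF that] by (auto simp: gaussian_space_def centered_gaussian_def)
  show ?thesis
  proof (rule distr_PiM_eqI_char[where X = "\<lambda>j p. ?Z p j" and Y = "\<lambda>j p. ?W p j"])
    fix t :: "bool \<times> 'b \<Rightarrow> real"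
    define A where "A \<omega> = (\<Sum>i\<in>I. t (False, i) * X i \<omega>)" for \<omega>
    define B where "B \<omega> = (\<Sum>i\<in>I. t (True, i) * X i \<omega>)" for \<omega>
    define r where "r = 1 / sqrt 2"
    have r: "x / sqrt 2 = r * x" for x
      by (simp add: r_def)
    define F where "F \<omega> = r * A \<omega> + r * B \<omega>" for \<omega>
    define G where "G \<omega> = (- r) * A \<omega> + r * B \<omega>" for \<omega>
    have AB: "A \<in> S" "B \<in> S"
      unfolding A_def B_def by (auto intro!: gaussian_space_sum[OF S fin] X)
    have FG: "F \<in> S" "G \<in> S"
      using S AB unfolding gaussian_space_def F_def G_def by blast+
    have cg: "centered_gaussian M H" if "H \<in> S" for H
      using S that by (auto simp: gaussian_space_def)
    have sq: "integrable M (\<lambda>\<omega>. (H \<omega>)\<^sup>2)" if "H \<in> S" for H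
      using cg[OF that] by (simp add: centered_gaussian_def)
    have "r\<^sup>2 = 1 / 2"
      by (simp add: r_def power_divide)
    moreover have "(F \<omega>)\<^sup>2 + (G \<omega>)\<^sup>2 = 2 * r\<^sup>2 * ((A \<omega>)\<^sup>2 + (B \<omega>)\<^sup>2)" for \<omega>
      by (simp add: F_def G_def power2_eq_square algebra_simps)
    ultimately have FG2: "(F \<omega>)\<^sup>2 + (G \<omega>)\<^sup>2 = (A \<omega>)\<^sup>2 + (B \<omega>)\<^sup>2" for \<omega>
      by simp
    have split: "(\<Sum>j\<in>UNIV \<times> I. h j) = (\<Sum>i\<in>I. h (False, i) + h (True, i))" for h :: "bool \<times> 'b \<Rightarrow> real"
      by (simp add: sum.cartesian_product' UNIV_bool sum.distrib add.commute)
    have Z: "(\<Sum>j\<in>UNIV \<times> I. t j * ?Z p j) = F (fst p) + G (snd p)" for p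
      unfolding split F_def G_def A_def B_def
      unfolding sum_distrib_left sum.distrib[symmetric]
      by (intro sum.cong refl) (simp add: r algebra_simps)
    have Z0: "(\<Sum>j\<in>UNIV \<times> I. t j * ?W p j) = A (fst p) + B (snd p)" for p
      unfolding split A_def B_def by (simp add: sum.distrib)
    have "(\<integral>\<omega>. (F \<omega>)\<^sup>2 \<partial>M) + (\<integral>\<omega>. (G \<omega>)\<^sup>2 \<partial>M) = (\<integral>\<omega>. (A \<omega>)\<^sup>2 \<partial>M) + (\<integral>\<omega>. (B \<omega>)\<^sup>2 \<partial>M)"
      using FG AB by (simp add: sq FG2 flip: Bochner_Integration.integral_add)
    then show "(CLINT p|M \<Otimes>\<^sub>M M. iexp (\<Sum>j\<in>UNIV \<times> I. t j * ?Z p j))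
        = (CLINT p|M \<Otimes>\<^sub>M M. iexp (\<Sum>j\<in>UNIV \<times> I. t j * ?W p j))"
      unfolding Z Z0 using FG AB by (simp only: char_pair_centered_gaussian[OF assms(1)] cg)
  qed (use fin P.prob_space_axioms in \<open>auto split: prod.splits\<close>)
qed

text \<open>The finite form of Fernique's theorem. The point is that the bound depends on the family only
  through the tail level \<open>c\<close>, not on the number of its members. The a priori finiteness of
  \<open>E K\<close> allows the term \<open>4q E K\<close> to be absorbed into the left-hand side.\<close>

lemma fernique_finite:
  assumes "prob_space M" and S: "gaussian_space M S" and fin: "finite I" "I \<noteq> {}"
    and X: "\<And>i. i \<in> I \<Longrightarrow> X i \<in> S"
    and K: "K = (\<lambda>\<omega>. Max ((\<lambda>i. (X i \<omega>)\<^sup>2) ` I))"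
    and prob: "measure M {\<omega> \<in> space M. c < K \<omega>} \<le> 1 / 10" and "0 \<le> c"
  shows "integrable M K" "(\<integral>\<omega>. K \<omega> \<partial>M) \<le> 12 * c"
proof -
  interpret prob_space M by fact
  interpret P: pair_prob_space M M ..
  have mX [measurable]: "X i \<in> borel_measurable M" and sq: "integrable M (\<lambda>\<omega>. (X i \<omega>)\<^sup>2)" if "i \<in> I" for i
    using S X[OF that] by (auto simp: gaussian_space_def centered_gaussian_def)
  have mK [measurable]: "K \<in> borel_measurable M"
    unfolding K using fin by measurable
  have K_ge: "(X i \<omega>)\<^sup>2 \<le> K \<omega>" if "i \<in> I" for i \<omega>
    unfolding K using fin that by (intro Max_ge) auto
  have K0: "0 \<le> K \<omega>" for \<omega>
    using fin K_ge[of _ \<omega>] by (meson all_not_in_conv order_trans zero_le_power2)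
  have K_le: "K \<omega> \<le> (\<Sum>i\<in>I. (X i \<omega>)\<^sup>2)" for \<omega>
    unfolding K using fin by (auto intro!: member_le_sum)
  show intK: "integrable M K"
  proof (rule Bochner_Integration.integrable_bound)
    show "integrable M (\<lambda>\<omega>. \<Sum>i\<in>I. (X i \<omega>)\<^sup>2)"
      using sq by auto
    show "AE \<omega> in M. norm (K \<omega>) \<le> norm (\<Sum>i\<in>I. (X i \<omega>)\<^sup>2)"
      using K_le K0 by (auto intro!: AE_I2 simp: sum_nonneg)
  qed measurable
  \<comment> \<open>The test function compared on both sides of the rotation; on the unrotated side its factors are independent.\<close>
  define f :: "(bool \<times> 'b \<Rightarrow> real) \<Rightarrow> real" where
    "f z = indicator {..c} (Max ((\<lambda>i. (z (False, i))\<^sup>2) ` I)) * Max ((\<lambda>i. (z (True, i))\<^sup>2) ` I)" for z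
  have [measurable]: "f \<in> borel_measurable (\<Pi>\<^sub>M j\<in>UNIV \<times> I. borel)"
    unfolding f_def using fin by measurable
  define Z where "Z p = (\<lambda>(b, i)\<in>UNIV \<times> I. (if b then X i (fst p) + X i (snd p) else X i (fst p) - X i (snd p)) / sqrt 2)" for p
  define Z0 where "Z0 p = (\<lambda>(b, i)\<in>UNIV \<times> I. X i (if b then snd p else fst p))" for p
  have [measurable]: "Z \<in> M \<Otimes>\<^sub>M M \<rightarrow>\<^sub>M (\<Pi>\<^sub>M j\<in>UNIV \<times> I. borel)" "Z0 \<in> M \<Otimes>\<^sub>M M \<rightarrow>\<^sub>M (\<Pi>\<^sub>M j\<in>UNIV \<times> I. borel)"
    unfolding Z_def Z0_def by (auto intro!: measurable_restrict split: prod.splits)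
  have "distr (M \<Otimes>\<^sub>M M) (\<Pi>\<^sub>M j\<in>UNIV \<times> I. borel) Z = distr (M \<Otimes>\<^sub>M M) (\<Pi>\<^sub>M j\<in>UNIV \<times> I. borel) Z0"
    unfolding Z_def Z0_def by (rule rotation_invariance[OF assms(1) S fin(1) X])
  then have "(\<integral>z. f z \<partial>distr (M \<Otimes>\<^sub>M M) (\<Pi>\<^sub>M j\<in>UNIV \<times> I. borel) Z) = (\<integral>z. f z \<partial>distr (M \<Otimes>\<^sub>M M) (\<Pi>\<^sub>M j\<in>UNIV \<times> I. borel) Z0)"
    by simp
  then have fZ: "(\<integral>p. f (Z p) \<partial>(M \<Otimes>\<^sub>M M)) = (\<integral>p. f (Z0 p) \<partial>(M \<Otimes>\<^sub>M M))"
    by (simp add: integral_distr)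
  have indM: "integrable M (\<lambda>\<omega>. indicator {..c} (K \<omega>) :: real)" "integrable M (\<lambda>\<omega>. indicator {c<..} (K \<omega>) :: real)"
    by (auto intro!: integrable_const_bound[where B = 1] AE_I2 simp: indicator_def)
  define q where "q = measure M {\<omega> \<in> space M. c < K \<omega>}"
  have q: "(\<integral>\<omega>. indicator {c<..} (K \<omega>) \<partial>M) = q"
  proof -
    have "(\<integral>\<omega>. indicator {c<..} (K \<omega>) \<partial>M) = (\<integral>\<omega>. indicat_real {\<omega> \<in> space M. c < K \<omega>} \<omega> \<partial>M)"
      by (intro Bochner_Integration.integral_cong) (auto simp: indicator_def)
    then show ?thesis by (simp add: q_def Int_absorb1 Int_absorb2)
  qed
  have q': "(\<integral>\<omega>. indicator {..c} (K \<omega>) \<partial>M) = 1 - q"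
  proof -
    have "(\<integral>\<omega>. indicator {..c} (K \<omega>) \<partial>M) = (\<integral>\<omega>. 1 - indicat_real {c<..} (K \<omega>) \<partial>M)"
      by (intro Bochner_Integration.integral_cong) (auto simp: indicator_def)
    then show ?thesis using indM by (simp add: q prob_space)
  qed
  have "f (Z0 p) = indicator {..c} (K (fst p)) * K (snd p)" for p
    using fin by (simp add: f_def Z0_def K cong: image_cong_simp)
  then have lhs: "(\<integral>p. f (Z0 p) \<partial>(M \<Otimes>\<^sub>M M)) = (1 - q) * (\<integral>\<omega>. K \<omega> \<partial>M)"
    using integral_pair_measure_mult(2)[OF assms(1,1) indM(1) intK] q' by simp
  have intKq: "integrable (M \<Otimes>\<^sub>M M) (\<lambda>p. K (fst p) * indicator {c<..} (K (snd p)))"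
    by (rule integral_pair_measure_mult[OF assms(1,1) intK indM(2)])
  have point: "f (Z p) \<le> 6 * c + 4 * (K (fst p) * indicator {c<..} (K (snd p)))" for p
  proof (cases "\<forall>i\<in>I. ((X i (fst p) - X i (snd p)) / sqrt 2)\<^sup>2 \<le> c")
    case True
    have "((X i (fst p) + X i (snd p)) / sqrt 2)\<^sup>2 \<le> 4 * min (K (fst p)) (K (snd p)) + 2 * c" if i: "i \<in> I" for i
    proof -
      let ?x = "X i (fst p)" and ?y = "X i (snd p)"
      have d: "(?x - ?y)\<^sup>2 \<le> 2 * c"
        using True i by (auto simp: power_divide field_simps)
      have id: "((?x + ?y) / sqrt 2)\<^sup>2 = (?x + ?y)\<^sup>2 / 2"
        by (simp add: power_divide)
      \<comment> \<open>Since \<open>x + y = 2x - (x - y)\<close>; by symmetry also with \<open>x\<close> and \<open>y\<close> exchanged.\<close>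
      have "(?x + ?y)\<^sup>2 \<le> 8 * ?x\<^sup>2 + 2 * (?x - ?y)\<^sup>2" "(?x + ?y)\<^sup>2 \<le> 8 * ?y\<^sup>2 + 2 * (?x - ?y)\<^sup>2"
        using zero_le_power2[of "3 * ?x - ?y"] zero_le_power2[of "3 * ?y - ?x"]
        by (simp_all add: power2_eq_square algebra_simps)
      then show ?thesis
        unfolding id using d K_ge[OF i, of "fst p"] K_ge[OF i, of "snd p"] by (simp add: min_def)
    qed
    then have "Max ((\<lambda>i. ((X i (fst p) + X i (snd p)) / sqrt 2)\<^sup>2) ` I) \<le> 4 * min (K (fst p)) (K (snd p)) + 2 * c"
      using fin by (subst Max_le_iff) auto
    moreover have "f (Z p) \<le> Max ((\<lambda>i. ((X i (fst p) + X i (snd p)) / sqrt 2)\<^sup>2) ` I)"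
      using fin True by (simp add: f_def Z_def cong: image_cong_simp)
    moreover have "min (K (fst p)) (K (snd p)) \<le> c + K (fst p) * indicator {c<..} (K (snd p))"
      using K0[of "fst p"] \<open>0 \<le> c\<close> by (auto simp: indicator_def min_def)
    ultimately show ?thesis by linarith
  next
    case False
    then have "f (Z p) = 0"
      using fin by (simp add: f_def Z_def Max_le_iff cong: image_cong_simp)
    then show ?thesis
      using K0[of "fst p"] \<open>0 \<le> c\<close> by (simp add: indicator_def)
  qed
  have "(\<integral>p. f (Z p) \<partial>(M \<Otimes>\<^sub>M M)) \<le> (\<integral>p. 6 * c + 4 * (K (fst p) * indicator {c<..} (K (snd p))) \<partial>(M \<Otimes>\<^sub>M M))"
    by (rule integral_mono') (use intKq point K0 \<open>0 \<le> c\<close> in auto)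
  also have "\<dots> = 6 * c + 4 * ((\<integral>\<omega>. K \<omega> \<partial>M) * q)"
    using intKq integral_pair_measure_mult(2)[OF assms(1,1) intK indM(2)]
    by (simp add: P.prob_space q)
  finally have "(1 - q) * (\<integral>\<omega>. K \<omega> \<partial>M) \<le> 6 * c + 4 * ((\<integral>\<omega>. K \<omega> \<partial>M) * q)"
    unfolding fZ lhs .
  moreover have "q * (\<integral>\<omega>. K \<omega> \<partial>M) \<le> 1 / 10 * (\<integral>\<omega>. K \<omega> \<partial>M)"
    using prob K0 by (intro mult_right_mono) (auto simp: q_def)
  ultimately show "(\<integral>\<omega>. K \<omega> \<partial>M) \<le> 12 * c"
    by (simp add: algebra_simps)
qed

text \<open>Almost sure boundedness provides one tail level that serves all finite subfamilies, and monotone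
  convergence passes from their maxima to the supremum.\<close>

lemma fernique:
  fixes X :: "nat \<Rightarrow> 'a \<Rightarrow> real"
  assumes "prob_space M" and S: "gaussian_space M S" and X: "\<And>n. X n \<in> S"
    and bdd: "AE \<omega> in M. bounded (range (\<lambda>n. X n \<omega>))"
  shows "(\<integral>\<^sup>+\<omega>. (SUP n. ennreal ((X n \<omega>)\<^sup>2)) \<partial>M) < \<infinity>"
proof -
  interpret prob_space M by fact
  have [measurable]: "X n \<in> borel_measurable M" for n
    using S X[of n] by (auto simp: gaussian_space_def centered_gaussian_def)
  define E where "E k = {\<omega> \<in> space M. \<exists>n. real k < (X n \<omega>)\<^sup>2}" for k :: nat
  have [measurable]: "E k \<in> sets M" for k
    unfolding E_def by measurable
  have "decseq E"
  proof (intro decseq_SucI subsetI)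
    fix n \<omega> assume "\<omega> \<in> E (Suc n)"
    then obtain i where "\<omega> \<in> space M" "real n + 1 < (X i \<omega>)\<^sup>2"
      by (auto simp: E_def algebra_simps)
    then have "\<omega> \<in> space M" "real n < (X i \<omega>)\<^sup>2"
      by auto
    then show "\<omega> \<in> E n"
      by (auto simp: E_def)
  qed
  then have "(\<lambda>k. measure M (E k)) \<longlonglongrightarrow> measure M (\<Inter>k. E k)"
    by (intro finite_Lim_measure_decseq) auto
  moreover have "measure M (\<Inter>k. E k) = 0"
  proof -
    have "AE \<omega> in M. \<omega> \<notin> (\<Inter>k. E k)"
      using bdd
    proof eventually_elim
      case (elim \<omega>)
      then obtain b where b: "\<And>n. \<bar>X n \<omega>\<bar> \<le> b"
        by (auto simp: bounded_iff)
      obtain k where "b\<^sup>2 \<le> real k"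
        using real_arch_simple by blast
      moreover have "(X n \<omega>)\<^sup>2 \<le> b\<^sup>2" for n
        using b[of n] by (metis abs_ge_zero power2_abs power_mono)
      ultimately have "\<omega> \<notin> E k"
        by (auto simp: E_def not_less intro: order_trans)
      then show ?case by auto
    qed
    then show ?thesis
      by (subst (asm) AE_iff_measurable[where N = "\<Inter>k. E k"]) (auto simp: E_def measure_def)
  qed
  ultimately have "\<forall>\<^sub>F k in sequentially. measure M (E k) < 1 / 10"
    by (intro order_tendstoD) auto
  then obtain k where k: "measure M (E k) < 1 / 10"
    by (auto dest: eventually_happens)
  define K where "K n \<omega> = Max ((\<lambda>i. (X i \<omega>)\<^sup>2) ` {..n})" for n \<omega>
  have K0: "0 \<le> K n \<omega>" for n \<omega>
    unfolding K_def by (intro order_trans[OF zero_le_power2[of "X 0 \<omega>"] Max_ge]) auto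
  have tail: "measure M {\<omega> \<in> space M. real k < K n \<omega>} \<le> 1 / 10" for n
  proof -
    have "{\<omega> \<in> space M. real k < K n \<omega>} \<subseteq> E k"
      by (auto simp: K_def E_def Max_gr_iff)
    then show ?thesis
      using k finite_measure_mono[of "{\<omega> \<in> space M. real k < K n \<omega>}" "E k"] by simp
  qed
  have "integrable M (K n)" "(\<integral>\<omega>. K n \<omega> \<partial>M) \<le> 12 * real k" for n
    using fernique_finite[OF assms(1) S, where I = "{..n}" and X = X and K = "K n" and c = "real k"] X tail[of n]
    by (simp_all add: K_def[abs_def])
  then have bound: "(\<integral>\<^sup>+\<omega>. ennreal (K n \<omega>) \<partial>M) \<le> ennreal (12 * real k)" for n
    using K0 by (subst nn_integral_eq_integral) (auto intro: ennreal_leI)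
  have SUP_K: "(SUP n. ennreal ((X n \<omega>)\<^sup>2)) = (SUP n. ennreal (K n \<omega>))" for \<omega>
  proof (intro antisym SUP_least)
    fix n
    show "ennreal ((X n \<omega>)\<^sup>2) \<le> (SUP n. ennreal (K n \<omega>))"
      by (rule SUP_upper2[of n]) (auto simp: K_def intro!: ennreal_leI Max_ge)
    have "K n \<omega> \<in> (\<lambda>i. (X i \<omega>)\<^sup>2) ` {..n}"
      unfolding K_def by (rule Max_in) auto
    then obtain i where "K n \<omega> = (X i \<omega>)\<^sup>2"
      by blast
    then show "ennreal (K n \<omega>) \<le> (SUP n. ennreal ((X n \<omega>)\<^sup>2))"
      by (simp only:) (rule SUP_upper, simp)
  qed
  have "incseq (\<lambda>n \<omega>. ennreal (K n \<omega>))"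
    by (intro incseq_SucI le_funI ennreal_leI) (auto simp: K_def intro!: Max_mono)
  then have "(\<integral>\<^sup>+\<omega>. (SUP n. ennreal (K n \<omega>)) \<partial>M) = (SUP n. \<integral>\<^sup>+\<omega>. ennreal (K n \<omega>) \<partial>M)"
    by (intro nn_integral_monotone_convergence_SUP) (auto simp: K_def)
  also have "\<dots> \<le> ennreal (12 * real k)"
    by (intro SUP_least bound)
  also have "\<dots> < \<infinity>"
    by simp
  finally show ?thesis
    unfolding SUP_K .
qed


section \<open>Suprema of partial derivatives\<close>

lemma (in complete_measure) borel_measurable_AE_eq:
  fixes f g :: "'a \<Rightarrow> 'b::topological_space"
  assumes f: "f \<in> borel_measurable M" and ae: "AE x in M. f x = g x"
  shows "g \<in> borel_measurable M"
proof (rule measurableI)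
  fix A :: "'b set" assume A: "A \<in> sets borel"
  show "g -` A \<inter> space M \<in> sets M"
  proof (rule in_sets_AE)
    show "AE x in M. x \<in> f -` A \<inter> space M \<longleftrightarrow> x \<in> g -` A \<inter> space M"
      using ae by eventually_elim auto
    show "f -` A \<inter> space M \<in> sets M"
      using f A by (rule measurable_sets)
  qed auto
qed simp

text \<open>The difference quotients along the steps \<open>1 / (k + 1)\<close>, written as linear combinations of values so
  that they visibly stay in a linear space of random variables.\<close>

lemma difference_quotient_tendsto_deriv:
  fixes f :: "real \<Rightarrow> real"
  assumes "f field_differentiable (at 0)"
  shows "(\<lambda>k. real (Suc k) * f (1 / real (Suc k)) + (- real (Suc k)) * f 0) \<longlonglongrightarrow> deriv f 0"
proof -
  have "(\<lambda>h. (f (0 + h) - f 0) / h) \<midarrow>0\<rightarrow> deriv f 0"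
    using assms by (simp add: DERIV_deriv_iff_field_differentiable[symmetric] DERIV_def)
  moreover have "filterlim (\<lambda>k. 1 / real (Suc k)) (at 0) sequentially"
    using LIMSEQ_inverse_real_of_nat by (auto simp: filterlim_at inverse_eq_divide simp del: of_nat_Suc)
  ultimately have "(\<lambda>k. (f (0 + 1 / real (Suc k)) - f 0) / (1 / real (Suc k))) \<longlonglongrightarrow> deriv f 0"
    by (rule filterlim_compose)
  then show ?thesis
    by (simp add: algebra_simps del: of_nat_Suc)
qed

text \<open>Each differentiation replaces the Gaussian space by its closure under almost sure limits. Centering
  by the derivatives of \<open>m\<close> is compatible with this, since both terms are differentiable separately.
  Completeness of the measure makes the derivative measurable even though it is a limit of difference
  quotients only almost surely.\<close>

lemma gaussian_space_partial_derivatives: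
  fixes V :: "'a::euclidean_space \<Rightarrow> 'w \<Rightarrow> real"
  assumes "prob_space M" "complete_measure M" "gaussian_process M V"
    and paths: "AE \<omega> in M. Cn n (\<lambda>y. V y \<omega>)"
    and m: "\<And>y. m y = (\<integral>\<omega>. V y \<omega> \<partial>M)" and Cn_m: "Cn n m"
    and "set bs \<subseteq> Basis" "length bs \<le> n"
  shows "\<exists>S. gaussian_space M S \<and>
    (\<forall>y. (\<lambda>\<omega>. iter_partial bs (\<lambda>y. V y \<omega>) y - iter_partial bs m y) \<in> S)"
  using assms(7,8)
proof (induction bs)
  case Nil
  let ?S = "{\<lambda>\<omega>. \<Sum>i\<in>I. c i * (V i \<omega> - (\<integral>\<omega>. V i \<omega> \<partial>M)) | I c. finite I}"
  have "(\<lambda>\<omega>. V y \<omega> - m y) \<in> ?S" for y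
    unfolding m by (auto intro!: exI[of _ "{y}"] exI[of _ "\<lambda>_. 1"])
  then show ?case
    using gaussian_space_gaussian_process[OF assms(1,3)] by auto
next
  case (Cons b bs)
  interpret complete_measure M by fact
  define W where "W y \<omega> = iter_partial bs (\<lambda>y. V y \<omega>) y - iter_partial bs m y" for y \<omega>
  obtain S where S: "gaussian_space M S" and W: "\<And>y. W y \<in> S"
    using Cons unfolding W_def[abs_def] by auto
  have b: "b \<in> Basis" "set bs \<subseteq> Basis" "length bs < n"
    using Cons.prems by auto
  have "(\<lambda>\<omega>. iter_partial (b # bs) (\<lambda>y. V y \<omega>) y - iter_partial (b # bs) m y) \<in> AE_closure M S" for y
  proof -
    define Y where "Y \<omega> = iter_partial (b # bs) (\<lambda>y. V y \<omega>) y - iter_partial (b # bs) m y" for \<omega>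
    define X where "X k \<omega> = real (Suc k) * W (y + (1 / real (Suc k)) *\<^sub>R b) \<omega> + (- real (Suc k)) * W y \<omega>" for k \<omega>
    have XS: "X k \<in> S" for k
      using S W unfolding gaussian_space_def X_def by blast
    have [measurable]: "X k \<in> borel_measurable M" for k
      using S XS[of k] by (simp add: gaussian_space_def centered_gaussian_def)
    have quot: "(\<lambda>k. real (Suc k) * iter_partial bs f (y + (1 / real (Suc k)) *\<^sub>R b) + (- real (Suc k)) * iter_partial bs f y)
        \<longlonglongrightarrow> iter_partial (b # bs) f y" if "Cn n f" for f
      using difference_quotient_tendsto_deriv[of "\<lambda>t. iter_partial bs f (y + t *\<^sub>R b)"] that b
      by (simp add: Cn_def partial_def)
    have lim: "AE \<omega> in M. (\<lambda>k. X k \<omega>) \<longlonglongrightarrow> Y \<omega>"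
      using paths
    proof eventually_elim
      case (elim \<omega>)
      show ?case
        using tendsto_diff[OF quot[OF elim] quot[OF Cn_m]]
        by (simp add: X_def W_def Y_def algebra_simps)
    qed
    have "Y \<in> borel_measurable M"
    proof (rule borel_measurable_AE_eq)
      show "(\<lambda>\<omega>. lim (\<lambda>k. X k \<omega>)) \<in> borel_measurable M"
        by measurable
      show "AE \<omega> in M. lim (\<lambda>k. X k \<omega>) = Y \<omega>"
        using lim by eventually_elim (rule limI)
    qed
    then show ?thesis
      using XS lim unfolding AE_closure_def Y_def by auto
  qed
  then show ?case
    using gaussian_space_AE_closure[OF assms(1) S] by blast
qed

text \<open>Fernique's theorem bounds the centered derivative on the countable set; the derivative of the mean
  is bounded on the compact set.\<close>

lemma SUP_partial_derivative_finite:
  fixes V :: "'a::euclidean_space \<Rightarrow> 'w \<Rightarrow> real"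
  assumes "prob_space M" "complete_measure M" "gaussian_process M V"
    and paths: "AE \<omega> in M. Cn n (\<lambda>y. V y \<omega>)"
    and m: "\<And>y. m y = (\<integral>\<omega>. V y \<omega> \<partial>M)" and Cn_m: "Cn n m"
    and bs: "set bs \<subseteq> Basis" "length bs \<le> n"
    and D: "compact D" and D0: "countable D0" "D0 \<subseteq> D"
  shows "(\<lambda>\<omega>. iter_partial bs (\<lambda>y. V y \<omega>) y) \<in> borel_measurable M"
    and "(\<integral>\<^sup>+\<omega>. (SUP y\<in>D0. ennreal ((iter_partial bs (\<lambda>y. V y \<omega>) y)\<^sup>2)) \<partial>M) < \<infinity>"
proof -
  interpret prob_space M by fact
  define W where "W y \<omega> = iter_partial bs (\<lambda>y. V y \<omega>) y - iter_partial bs m y" for y \<omega>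
  obtain S where S: "gaussian_space M S" and W: "\<And>y. W y \<in> S"
    using gaussian_space_partial_derivatives[OF assms(1-6) bs] unfolding W_def[abs_def] by auto
  have mW [measurable]: "W y \<in> borel_measurable M" for y
    using S W[of y] by (simp add: gaussian_space_def centered_gaussian_def)
  have V_eq: "iter_partial bs (\<lambda>y. V y \<omega>) y = W y \<omega> + iter_partial bs m y" for y \<omega>
    by (simp add: W_def)
  have cont: "continuous_on UNIV (iter_partial bs f)" if "Cn n f" for f :: "'a \<Rightarrow> real"
    using that bs by (simp add: Cn_def)
  show "(\<lambda>\<omega>. iter_partial bs (\<lambda>y. V y \<omega>) y) \<in> borel_measurable M"
    unfolding V_eq by measurable
  show "(\<integral>\<^sup>+\<omega>. (SUP y\<in>D0. ennreal ((iter_partial bs (\<lambda>y. V y \<omega>) y)\<^sup>2)) \<partial>M) < \<infinity>"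
  proof (cases "D0 = {}")
    case True
    then show ?thesis by (simp add: bot_ennreal)
  next
    case False
    define e where "e = from_nat_into D0"
    have e: "range e = D0"
      unfolding e_def using False D0(1) by (rule range_from_nat_into)
    have bdd: "bounded (range (\<lambda>k. f (e k)))" if "continuous_on UNIV f" for f :: "'a \<Rightarrow> real"
    proof -
      have "bounded (f ` D)"
        using D that by (intro compact_imp_bounded compact_continuous_image) (auto intro: continuous_on_subset)
      then show ?thesis
        by (rule bounded_subset) (use e D0(2) in auto)
    qed
    obtain B where B: "\<And>k. \<bar>iter_partial bs m (e k)\<bar> \<le> B"
      using bdd[OF cont[OF Cn_m]] by (auto simp: bounded_iff)
    have sup: "(\<integral>\<^sup>+\<omega>. (SUP k. ennreal ((W (e k) \<omega>)\<^sup>2)) \<partial>M) < \<infinity>"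
    proof (rule fernique[OF assms(1) S])
      show "AE \<omega> in M. bounded (range (\<lambda>k. W (e k) \<omega>))"
        using paths
      proof eventually_elim
        case (elim \<omega>)
        show ?case
          unfolding W_def by (intro bdd continuous_on_diff cont elim Cn_m)
      qed
    qed (rule W)
    have "(\<integral>\<^sup>+\<omega>. (SUP y\<in>D0. ennreal ((iter_partial bs (\<lambda>y. V y \<omega>) y)\<^sup>2)) \<partial>M)
        \<le> (\<integral>\<^sup>+\<omega>. 2 * (SUP k. ennreal ((W (e k) \<omega>)\<^sup>2)) + ennreal (2 * B\<^sup>2) \<partial>M)"
    proof (intro nn_integral_mono SUP_least)
      fix \<omega> y assume "y \<in> D0"
      then obtain k where y: "y = e k"
        using e by auto
      have "(iter_partial bs m y)\<^sup>2 \<le> B\<^sup>2"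
        using B[of k] y by (metis abs_ge_zero power2_abs power_mono)
      moreover have "(W y \<omega> + iter_partial bs m y)\<^sup>2 \<le> 2 * (W y \<omega>)\<^sup>2 + 2 * (iter_partial bs m y)\<^sup>2"
        using zero_le_power2[of "W y \<omega> - iter_partial bs m y"] by (simp add: power2_eq_square algebra_simps)
      ultimately have "(iter_partial bs (\<lambda>y. V y \<omega>) y)\<^sup>2 \<le> 2 * (W y \<omega>)\<^sup>2 + 2 * B\<^sup>2"
        unfolding V_eq by linarith
      then have "ennreal ((iter_partial bs (\<lambda>y. V y \<omega>) y)\<^sup>2) \<le> ennreal (2 * (W y \<omega>)\<^sup>2 + 2 * B\<^sup>2)"
        by (rule ennreal_leI)
      also have "\<dots> = 2 * ennreal ((W y \<omega>)\<^sup>2) + ennreal (2 * B\<^sup>2)"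
        by (simp add: ennreal_plus ennreal_mult)
      also have "\<dots> \<le> 2 * (SUP k. ennreal ((W (e k) \<omega>)\<^sup>2)) + ennreal (2 * B\<^sup>2)"
        unfolding y by (intro add_right_mono mult_left_mono SUP_upper) auto
      finally show "ennreal ((iter_partial bs (\<lambda>y. V y \<omega>) y)\<^sup>2)
          \<le> 2 * (SUP k. ennreal ((W (e k) \<omega>)\<^sup>2)) + ennreal (2 * B\<^sup>2)" .
    qed
    also have "\<dots> = 2 * (\<integral>\<^sup>+\<omega>. (SUP k. ennreal ((W (e k) \<omega>)\<^sup>2)) \<partial>M) + ennreal (2 * B\<^sup>2)"
      by (subst nn_integral_add) (auto simp: nn_integral_cmult emeasure_space_1)
    also have "\<dots> < \<infinity>"
      using sup by (simp add: ennreal_mult_less_top)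
    finally show ?thesis .
  qed
qed

lemma SUP_eq_SUP_dense:
  fixes g :: "'a::topological_space \<Rightarrow> real"
  assumes g: "continuous_on UNIV g" and D0: "D0 \<subseteq> D" "D \<subseteq> closure D0"
  shows "(SUP y\<in>D. ennreal (g y)) = (SUP y\<in>D0. ennreal (g y))"
proof (rule antisym)
  show "(SUP y\<in>D0. ennreal (g y)) \<le> (SUP y\<in>D. ennreal (g y))"
    using D0(1) by (rule SUP_subset_mono) simp
  show "(SUP y\<in>D. ennreal (g y)) \<le> (SUP y\<in>D0. ennreal (g y))"
  proof (rule SUP_least)
    fix y assume "y \<in> D"
    let ?A = "{z. ennreal (g z) \<le> (SUP y\<in>D0. ennreal (g y))}"
    have "closed ?A"
      using g by (intro closed_Collect_le continuous_intros continuous_on_ennreal)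
    moreover have "D0 \<subseteq> ?A"
      by (auto intro: SUP_upper)
    ultimately have "closure D0 \<subseteq> ?A"
      by (rule closure_minimal[rotated])
    then show "ennreal (g y) \<le> (SUP y\<in>D0. ennreal (g y))"
      using \<open>y \<in> D\<close> D0(2) by auto
  qed
qed

text \<open>The common form of the three bounds: \<open>Q\<close> is a seminorm applied to a vector of partial derivatives,
  the \<open>i\<close>-th of which is taken in the directions \<open>dirs i\<close>. Subadditivity together with the bound by
  the norm makes \<open>Q\<close> Lipschitz. This yields measurability and reduces the supremum to a countable
  dense subset, while the squared bound leaves a finite sum of suprema of single derivatives.\<close>

lemma expectation_le_SUP_partial_derivatives:
  fixes V :: "'a::euclidean_space \<Rightarrow> 'w \<Rightarrow> real" and Q :: "real^'i \<Rightarrow> real" and dirs :: "'i \<Rightarrow> 'a list"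
  assumes "prob_space M" "complete_measure M" "gaussian_process M V"
    and paths: "AE \<omega> in M. Cn n (\<lambda>y. V y \<omega>)"
    and m: "\<And>y. m y = (\<integral>\<omega>. V y \<omega> \<partial>M)" and Cn_m: "Cn n m"
    and dirs: "\<And>i. set (dirs i) \<subseteq> Basis" "\<And>i. length (dirs i) \<le> n"
    and Q_add: "\<And>u v. Q (u + v) \<le> Q u + Q v" and Q_nonneg: "\<And>u. 0 \<le> Q u" and Q_le: "\<And>u. Q u \<le> L * norm u"
    and D: "compact D"
  shows "\<exists>C>0. expectation_le M (\<lambda>\<omega>. SUP y\<in>D. ennreal ((Q (\<chi> i. iter_partial (dirs i) (\<lambda>y. V y \<omega>) y))\<^sup>2)) C"
proof -
  interpret prob_space M by fact
  interpret C: complete_measure M by fact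
  have "\<bar>Q u - Q v\<bar> \<le> L * norm (u - v)" for u v
    using Q_add[of v "u - v"] Q_add[of u "v - u"] Q_le[of "u - v"] Q_le[of "v - u"]
    by (simp add: norm_minus_commute abs_le_iff)
  then have "L-lipschitz_on UNIV Q" if "0 \<le> L"
    using that by (intro lipschitz_onI) (auto simp: dist_norm)
  moreover have "0 \<le> L"
    using order_trans[OF Q_nonneg Q_le, of "axis undefined 1"] by simp
  ultimately have Q_cont: "continuous_on UNIV Q"
    using lipschitz_on_continuous_on by blast
  then have [measurable]: "Q \<in> borel_measurable borel"
    by (rule borel_measurable_continuous_onI)
  obtain D0 where D0: "countable D0" "D0 \<subseteq> D" "D \<subseteq> closure D0"
    using separable[of D] by blast
  define U where "U \<omega> y = (\<chi> i. iter_partial (dirs i) (\<lambda>y. V y \<omega>) y)" for \<omega> y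
  note partial = SUP_partial_derivative_finite[OF assms(1-6) dirs D D0(1,2)]
  have [measurable]: "(\<lambda>\<omega>. iter_partial (dirs i) (\<lambda>y. V y \<omega>) y) \<in> borel_measurable M" for i y
    by (rule partial(1))
  have mU [measurable]: "(\<lambda>\<omega>. U \<omega> y) \<in> borel_measurable M" for y
    unfolding U_def by (subst borel_measurable_euclidean_space)
      (auto simp: Basis_vec_def inner_axis)
  have ae: "AE \<omega> in M. (SUP y\<in>D0. ennreal ((Q (U \<omega> y))\<^sup>2)) = (SUP y\<in>D. ennreal ((Q (U \<omega> y))\<^sup>2))"
    using paths
  proof eventually_elim
    case (elim \<omega>)
    have "continuous_on UNIV (U \<omega>)"
      unfolding U_def using elim dirs by (intro continuous_on_vec_lambda) (simp add: Cn_def)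
    then have "continuous_on UNIV (\<lambda>y. (Q (U \<omega> y))\<^sup>2)"
      by (intro continuous_intros continuous_on_compose2[OF Q_cont]) auto
    then show ?case
      by (intro SUP_eq_SUP_dense[symmetric] D0)
  qed
  have meas: "(\<lambda>\<omega>. SUP y\<in>D. ennreal ((Q (U \<omega> y))\<^sup>2)) \<in> borel_measurable M"
    by (rule C.borel_measurable_AE_eq[OF _ ae]) (use D0(1) in measurable)
  have "(\<integral>\<^sup>+\<omega>. (SUP y\<in>D. ennreal ((Q (U \<omega> y))\<^sup>2)) \<partial>M) = (\<integral>\<^sup>+\<omega>. (SUP y\<in>D0. ennreal ((Q (U \<omega> y))\<^sup>2)) \<partial>M)"
    using ae by (intro nn_integral_cong_AE) (auto simp: eq_commute)
  also have "\<dots> \<le> (\<integral>\<^sup>+\<omega>. ennreal (L\<^sup>2) * (\<Sum>i\<in>UNIV. SUP y\<in>D0. ennreal ((iter_partial (dirs i) (\<lambda>y. V y \<omega>) y)\<^sup>2)) \<partial>M)"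
  proof (intro nn_integral_mono SUP_least)
    fix \<omega> y assume y: "y \<in> D0"
    have "(Q (U \<omega> y))\<^sup>2 \<le> (L * norm (U \<omega> y))\<^sup>2"
      using Q_nonneg Q_le by (intro power_mono)
    also have "\<dots> = L\<^sup>2 * (\<Sum>i\<in>UNIV. (iter_partial (dirs i) (\<lambda>y. V y \<omega>) y)\<^sup>2)"
      by (simp add: power_mult_distrib norm_vec_def L2_set_def sum_nonneg U_def)
    finally have "ennreal ((Q (U \<omega> y))\<^sup>2) \<le> ennreal (L\<^sup>2) * (\<Sum>i\<in>UNIV. ennreal ((iter_partial (dirs i) (\<lambda>y. V y \<omega>) y)\<^sup>2))"
      by (simp add: sum_ennreal sum_nonneg ennreal_leI flip: ennreal_mult)
    also have "\<dots> \<le> ennreal (L\<^sup>2) * (\<Sum>i\<in>UNIV. SUP y\<in>D0. ennreal ((iter_partial (dirs i) (\<lambda>y. V y \<omega>) y)\<^sup>2))"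
      by (intro mult_left_mono sum_mono SUP_upper y) auto
    finally show "ennreal ((Q (U \<omega> y))\<^sup>2) \<le> ennreal (L\<^sup>2) * (\<Sum>i\<in>UNIV. SUP y\<in>D0. ennreal ((iter_partial (dirs i) (\<lambda>y. V y \<omega>) y)\<^sup>2))" .
  qed
  also have "\<dots> = ennreal (L\<^sup>2) * (\<Sum>i\<in>UNIV. \<integral>\<^sup>+\<omega>. (SUP y\<in>D0. ennreal ((iter_partial (dirs i) (\<lambda>y. V y \<omega>) y)\<^sup>2)) \<partial>M)"
  proof -
    have [measurable]: "(\<lambda>\<omega>. SUP y\<in>D0. ennreal ((iter_partial (dirs i) (\<lambda>y. V y \<omega>) y)\<^sup>2)) \<in> borel_measurable M" for i
      using D0(1) by measurable
    show ?thesis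
      by (subst nn_integral_cmult) (auto simp: nn_integral_sum)
  qed
  also have "\<dots> < \<infinity>"
    using partial(2) by (auto simp: ennreal_mult_less_top)
  finally have fin: "(\<integral>\<^sup>+\<omega>. (SUP y\<in>D. ennreal ((Q (U \<omega> y))\<^sup>2)) \<partial>M) < \<infinity>" .
  define C where "C = enn2real (\<integral>\<^sup>+\<omega>. (SUP y\<in>D. ennreal ((Q (U \<omega> y))\<^sup>2)) \<partial>M) + 1"
  have "(\<integral>\<^sup>+\<omega>. (SUP y\<in>D. ennreal ((Q (U \<omega> y))\<^sup>2)) \<partial>M) \<le> ennreal C"
    using fin ennreal_leI[of "C - 1" C] by (simp add: C_def ennreal_enn2real)
  moreover have "C > 0"
    unfolding C_def by (simp add: add_nonneg_pos)
  ultimately show ?thesis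
    using meas unfolding expectation_le_def U_def by blast
qed


section \<open>The gradient, the Hessian and the third derivative\<close>

text \<open>The operator norm is at most the sum of the absolute values of the entries, each of which is at
  most the norm of the vector of all entries.\<close>

lemma matrix_op_norm_seminorm:
  fixes u v :: "real^('d::finite \<times> 'd)"
  defines "N \<equiv> \<lambda>u::real^('d::finite \<times> 'd). matrix_op_norm (\<chi> i j. u $ (i, j))"
  shows "N (u + v) \<le> N u + N v" "0 \<le> N u" "N u \<le> (real CARD('d))\<^sup>2 * norm u"
proof -
  have lin: "bounded_linear (\<lambda>x. A *v x)" for A :: "real^'d^'d"
    by simp
  have "(\<chi> i j. (u + v) $ (i, j)) = (\<chi> i j. u $ (i, j)) + (\<chi> i j. v $ (i, j) :: real^'d^'d)"
    by (simp add: vec_eq_iff)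
  then show "N (u + v) \<le> N u + N v"
    unfolding N_def matrix_op_norm_def
    using onorm_triangle[OF lin lin] by (simp flip: matrix_vector_mult_add_rdistrib)
  show "0 \<le> N u"
    unfolding N_def matrix_op_norm_def by (intro onorm_pos_le lin)
  have "N u \<le> (\<Sum>i\<in>UNIV. \<Sum>j\<in>UNIV. \<bar>(\<chi> i j. u $ (i, j)) $ i $ j\<bar>)"
    unfolding N_def matrix_op_norm_def by (rule onorm_le_matrix_component_sum)
  also have "\<dots> \<le> (\<Sum>i\<in>(UNIV::'d set). \<Sum>j\<in>(UNIV::'d set). norm u)"
    by (intro sum_mono) (simp add: component_le_norm_cart)
  finally show "N u \<le> (real CARD('d))\<^sup>2 * norm u"
    by (simp add: power2_eq_square)
qed

text \<open>The supremum over unit vectors is a genuine supremum: the set of values is bounded, by the sum of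
  the absolute values of the entries, and unit vectors exist since the index type is nonempty.\<close>

lemma tensor_op_norm_seminorm:
  fixes u v :: "real^('d::finite \<times> 'd \<times> 'd)"
  defines "T \<equiv> \<lambda>(u::real^('d::finite \<times> 'd \<times> 'd)) v1 v2. \<Sum>i\<in>UNIV. \<Sum>j\<in>UNIV. \<Sum>k\<in>UNIV.
      (u $ (i, j, k) * v1 $ i * v2 $ j) *\<^sub>R (axis k 1 :: real^'d)"
  shows "tensor_op_norm (T (u + v)) \<le> tensor_op_norm (T u) + tensor_op_norm (T v)"
    "0 \<le> tensor_op_norm (T u)" "tensor_op_norm (T u) \<le> real CARD('d) ^ 3 * norm u"
proof -
  let ?S = "{(v1, v2). norm v1 = 1 \<and> norm v2 = 1} :: ((real^'d) \<times> (real^'d)) set"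
  have le: "norm (T u v1 v2) \<le> real CARD('d) ^ 3 * norm u" if "norm v1 = 1" "norm v2 = 1" for u v1 v2
  proof -
    have "norm (T u v1 v2) \<le> (\<Sum>i\<in>(UNIV::'d set). \<Sum>j\<in>(UNIV::'d set). \<Sum>k\<in>(UNIV::'d set). norm u)"
      unfolding T_def
    proof (intro order_trans[OF norm_sum] sum_mono)
      fix i j k :: 'd
      have "\<bar>u $ (i, j, k)\<bar> * \<bar>v1 $ i\<bar> * \<bar>v2 $ j\<bar> \<le> norm u * 1 * 1"
        using that component_le_norm_cart[of v1 i] component_le_norm_cart[of v2 j]
        by (intro mult_mono) (auto intro: component_le_norm_cart)
      then show "norm ((u $ (i, j, k) * v1 $ i * v2 $ j) *\<^sub>R (axis k 1 :: real^'d)) \<le> norm u"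
        by (simp add: abs_mult)
    qed
    then show ?thesis
      by (simp add: power3_eq_cube mult.assoc)
  qed
  have bdd: "bdd_above ((\<lambda>(v1, v2). norm (T u v1 v2)) ` ?S)" for u
    using le by (auto intro!: bdd_aboveI)
  have mem: "(axis undefined 1, axis undefined 1) \<in> ?S"
    by simp
  then have ne: "?S \<noteq> {}"
    by blast
  have upper: "norm (T u v1 v2) \<le> tensor_op_norm (T u)" if "norm v1 = 1" "norm v2 = 1" for u v1 v2
    unfolding tensor_op_norm_def using cSUP_upper[OF _ bdd, of "(v1, v2)" u] that by simp
  show "0 \<le> tensor_op_norm (T u)"
    using order_trans[OF norm_ge_zero upper[of "axis undefined 1" "axis undefined 1" u]] by simp
  show "tensor_op_norm (T u) \<le> real CARD('d) ^ 3 * norm u"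
    unfolding tensor_op_norm_def using le by (intro cSUP_least ne) auto
  have "T (u + v) v1 v2 = T u v1 v2 + T v v1 v2" for v1 v2
    by (simp add: T_def sum.distrib distrib_right scaleR_add_left)
  then have "norm (T (u + v) v1 v2) \<le> tensor_op_norm (T u) + tensor_op_norm (T v)" if "norm v1 = 1" "norm v2 = 1" for v1 v2
    using norm_triangle_ineq[of "T u v1 v2" "T v v1 v2"] upper[OF that, of u] upper[OF that, of v] by simp
  then show "tensor_op_norm (T (u + v)) \<le> tensor_op_norm (T u) + tensor_op_norm (T v)"
    unfolding tensor_op_norm_def[of "T (u + v)"] by (intro cSUP_least ne) auto
qed

theorem theorem2p4:
  fixes M :: "'w measure"
    and V :: "real^'d \<Rightarrow> 'w \<Rightarrow> real"
    and m :: "real^'d \<Rightarrow> real"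
    and k :: "(real^'d) \<times> (real^'d) \<Rightarrow> real"
  assumes "prob_space M"
    and "complete_measure M"
    and "gaussian_process M V"
    and "AE \<omega> in M. Cn 3 (\<lambda>y. V y \<omega>)"
    and "\<And>y. m y = (\<integral>\<omega>. V y \<omega> \<partial>M)"
    and "\<And>y y'. k (y, y') = covariance M (V y) (V y')"
    and "Cn 3 m"
    and "Cn 6 k"
    and "\<And>bs. set bs \<subseteq> Basis \<Longrightarrow> 1 \<le> length bs \<Longrightarrow> length bs \<le> 6 \<Longrightarrow>
           bounded (range (iter_partial bs k))"
  shows "\<forall>D. compact D \<longrightarrow> (\<exists>C1 C2 C3 :: real. C1 > 0 \<and> C2 > 0 \<and> C3 > 0 \<and>
     expectation_le M (\<lambda>\<omega>. SUP y\<in>D. ennreal ((norm (grad (\<lambda>y. V y \<omega>) y))\<^sup>2)) C1 \<and>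
     expectation_le M (\<lambda>\<omega>. SUP y\<in>D. ennreal ((matrix_op_norm (hess (\<lambda>y. V y \<omega>) y))\<^sup>2)) C2 \<and>
     expectation_le M (\<lambda>\<omega>. SUP y\<in>D. ennreal ((tensor_op_norm (third_deriv (\<lambda>y. V y \<omega>) y))\<^sup>2)) C3)"
proof (intro allI impI)
  fix D :: "(real^'d) set" assume D: "compact D"
  have axis_in: "axis i 1 \<in> (Basis :: (real^'d) set)" for i
    by (auto simp: Basis_vec_def)
  note bound = expectation_le_SUP_partial_derivatives[OF assms(1-5,7), where D = D, OF _ _ _ _ _ D]
  have "\<exists>C>0. expectation_le M (\<lambda>\<omega>. SUP y\<in>D. ennreal ((norm (\<chi> i. iter_partial [axis i 1] (\<lambda>y. V y \<omega>) y))\<^sup>2)) C"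
    by (rule bound[where Q = norm and L = 1]) (auto intro: norm_triangle_ineq simp: axis_in)
  moreover have "\<exists>C>0. expectation_le M (\<lambda>\<omega>. SUP y\<in>D. ennreal ((matrix_op_norm (\<chi> i j.
      (\<chi> ij. iter_partial (case ij of (i, j) \<Rightarrow> [axis i 1, axis j 1]) (\<lambda>y. V y \<omega>) y) $ (i, j)))\<^sup>2)) C"
    by (intro matrix_op_norm_seminorm bound[where Q = "\<lambda>u. matrix_op_norm (\<chi> i j. u $ (i, j))" and L = "(real CARD('d))\<^sup>2"])
      (auto simp: axis_in split: prod.splits)
  moreover have "\<exists>C>0. expectation_le M (\<lambda>\<omega>. SUP y\<in>D. ennreal ((tensor_op_norm (\<lambda>v1 v2.
      \<Sum>i\<in>UNIV. \<Sum>j\<in>UNIV. \<Sum>k\<in>UNIV. ((\<chi> ijk. iter_partial (case ijk of (i, j, k) \<Rightarrow> [axis i 1, axis j 1, axis k 1])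
        (\<lambda>y. V y \<omega>) y) $ (i, j, k) * v1 $ i * v2 $ j) *\<^sub>R (axis k 1 :: real^'d)))\<^sup>2)) C"
    by (intro tensor_op_norm_seminorm bound[where Q = "\<lambda>u. tensor_op_norm (\<lambda>v1 v2. \<Sum>i\<in>UNIV. \<Sum>j\<in>UNIV. \<Sum>k\<in>UNIV.
          (u $ (i, j, k) * v1 $ i * v2 $ j) *\<^sub>R (axis k 1 :: real^'d))" and L = "real CARD('d) ^ 3"])
      (auto simp: axis_in split: prod.splits)
  ultimately show "\<exists>C1 C2 C3 :: real. C1 > 0 \<and> C2 > 0 \<and> C3 > 0 \<and>
     expectation_le M (\<lambda>\<omega>. SUP y\<in>D. ennreal ((norm (grad (\<lambda>y. V y \<omega>) y))\<^sup>2)) C1 \<and>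
     expectation_le M (\<lambda>\<omega>. SUP y\<in>D. ennreal ((matrix_op_norm (hess (\<lambda>y. V y \<omega>) y))\<^sup>2)) C2 \<and>
     expectation_le M (\<lambda>\<omega>. SUP y\<in>D. ennreal ((tensor_op_norm (third_deriv (\<lambda>y. V y \<omega>) y))\<^sup>2)) C3"
    unfolding grad_def hess_def third_deriv_def vec_lambda_beta prod.case by blast
qed

end
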